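(* Let $\Omega\subset\mathbb R^d$, $d\ge2$, be a bounded connected polytope. Then $$(H_0(\operatorname{div},\Omega))'=\operatorname{div}H^{-1}(\operatorname{curl}\operatorname{div},\Omega;\mathbb S\cap\mathbb T)+\nabla L_0^2(\Omega),$$ and this decomposition is stable: there is a constant $C>0$ such that every $w\in(H_0(\operatorname{div},\Omega))'$ can be written as $w=\operatorname{div}\tau+\nabla q$ with $\tau\in H^{-1}(\operatorname{curl}\operatorname{div},\Omega;\mathbb S\cap\mathbb T)$, $q\in L_0^2(\Omega)$ and $$\|\tau\|_{H^{-1}(\operatorname{curl}\operatorname{div})}+\|q\|_0\le C\|w\|_{(H_0(\operatorname{div},\Omega))'}.$$
   Context: $\mathbb S$ and $\mathbb T$ are the symmetric and the traceless matrices in $\mathbb R^{d\times d}$. The divergence of a matrix field is taken row-wise. $\|\cdot\|_0$ is the $L^2(\Omega)$ norm, $(\cdot,\cdot)$ the $L^2(\Omega)$ inner product. $H(\operatorname{div},\Omega)=\{v\in L^2(\Omega;\mathbb R^d):\operatorname{div}v\in L^2(\Omega)\}$ with $\|v\|_{H(\operatorname{div})}^2=\|v\|_0^2+\|\operatorname{div}v\|_0^2$; $H_0(\operatorname{div},\Omega)$ is the subspace with vanishing normal trace on $\partial\Omega$; the prime denotes the dual space with the dual norm. $L_0^2(\Omega)$ is the space of $L^2$ functions of zero mean. For $q\in L^2(\Omega)$, $\nabla q\in(H_0(\operatorname{div},\Omega))'$ is defined by $\langle\nabla q,v\rangle:=-(q,\operatorname{div}v)$. $H^{-1}(\operatorname{curl}\operatorname{div},\Omega;\mathbb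 S\cap\mathbb T):=\{\tau\in L^2(\Omega;\mathbb S\cap\mathbb T):\operatorname{div}\tau\in(H_0(\operatorname{div},\Omega))'\}$ (the distributional divergence extends to a bounded functional on $H_0(\operatorname{div},\Omega)$), with norm $\|\tau\|_{H^{-1}(\operatorname{curl}\operatorname{div})}^2:=\|\tau\|_0^2+\|\operatorname{div}\tau\|_{(H_0(\operatorname{div},\Omega))'}^2$. *)

theory Defs
  imports "HOL-Analysis.Analysis"
begin

text \<open>
  Elements of \<open>L\<^sup>2\<close> spaces are represented by functions on the whole space, of which only the
  values almost everywhere on \<open>\<Omega>\<close> matter; the norms below are therefore seminorms on
  representatives, and a bounded functional automatically respects almost-everywhere equality.
\<close>

text \<open>
  Open polytopal domains, not necessarily convex (the library's \<^const>\<open>polytope\<close> is a convex hull of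
  finitely many points). No Lipschitz condition is imposed; taking the interior of the closed
  union excludes slits.
\<close>

definition polytopal_domain :: "'a::euclidean_space set \<Rightarrow> bool" where
  "polytopal_domain \<Omega> \<longleftrightarrow>
     (\<exists>\<P>. finite \<P> \<and> (\<forall>P\<in>\<P>. polytope P) \<and> \<Omega> = interior (\<Union>\<P>)) \<and> \<Omega> \<noteq> {}"

subsection \<open>Lebesgue spaces\<close>

definition L2 :: "'a::euclidean_space set \<Rightarrow> 'b::euclidean_space set \<Rightarrow> ('a \<Rightarrow> 'b) set" where
  "L2 \<Omega> X = {f \<in> borel_measurable (lebesgue_on \<Omega>).
      integrable (lebesgue_on \<Omega>) (\<lambda>x. (norm (f x))\<^sup>2) \<and> (AE x in lebesgue_on \<Omega>. f x \<in> X)}"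

definition l2_inner ::
  "'a::euclidean_space set \<Rightarrow> ('a \<Rightarrow> 'b::euclidean_space) \<Rightarrow> ('a \<Rightarrow> 'b) \<Rightarrow> real" where
  "l2_inner \<Omega> f g = (LINT x|lebesgue_on \<Omega>. f x \<bullet> g x)"

definition l2_norm :: "'a::euclidean_space set \<Rightarrow> ('a \<Rightarrow> 'b::euclidean_space) \<Rightarrow> real" where
  "l2_norm \<Omega> f = sqrt (l2_inner \<Omega> f f)"

definition L2_zero_mean :: "'a::euclidean_space set \<Rightarrow> ('a \<Rightarrow> real) set" where
  "L2_zero_mean \<Omega> = {q \<in> L2 \<Omega> UNIV. (LINT x|lebesgue_on \<Omega>. q x) = 0}"

definition sym_traceless :: "(real^'n^'n) set" where
  "sym_traceless = {A. transpose A = A \<and> trace A = 0}"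

subsection \<open>Test functions\<close>

primrec C_k :: "nat \<Rightarrow> ('a::euclidean_space \<Rightarrow> 'b::real_normed_vector) \<Rightarrow> bool" where
  "C_k 0 f \<longleftrightarrow> continuous_on UNIV f"
| "C_k (Suc k) f \<longleftrightarrow>
     (\<forall>x. f differentiable (at x)) \<and> (\<forall>h. C_k k (\<lambda>x. frechet_derivative f (at x) h))"

definition test_functions ::
  "'a::euclidean_space set \<Rightarrow> ('a \<Rightarrow> 'b::real_normed_vector) set" where
  "test_functions \<Omega> = {\<phi>. (\<forall>k. C_k k \<phi>) \<and>
      compact (closure {x. \<phi> x \<noteq> 0}) \<and> closure {x. \<phi> x \<noteq> 0} \<subseteq> \<Omega>}"

definition gradient :: "(real^'n \<Rightarrow> real) \<Rightarrow> real^'n \<Rightarrow> real^'n" where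
  "gradient \<phi> x = (\<chi> i. frechet_derivative \<phi> (at x) (axis i 1))"

subsection \<open>Weak derivatives and Sobolev spaces\<close>

definition is_weak_div ::
  "(real^'n) set \<Rightarrow> (real^'n \<Rightarrow> real^'n) \<Rightarrow> (real^'n \<Rightarrow> real) \<Rightarrow> bool" where
  "is_weak_div \<Omega> v g \<longleftrightarrow> g \<in> L2 \<Omega> UNIV \<and>
     (\<forall>\<phi>\<in>test_functions \<Omega>. l2_inner \<Omega> v (gradient \<phi>) = - l2_inner \<Omega> g \<phi>)"

text \<open>The weak derivatives are unique up to null sets, so the choice below is immaterial.\<close>

definition weak_div ::
  "(real^'n) set \<Rightarrow> (real^'n \<Rightarrow> real^'n) \<Rightarrow> real^'n \<Rightarrow> real" where
  "weak_div \<Omega> v = (SOME g. is_weak_div \<Omega> v g)"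

definition is_weak_grad ::
  "(real^'n) set \<Rightarrow> (real^'n \<Rightarrow> real) \<Rightarrow> (real^'n \<Rightarrow> real^'n) \<Rightarrow> bool" where
  "is_weak_grad \<Omega> u g \<longleftrightarrow> g \<in> L2 \<Omega> UNIV \<and>
     (\<forall>\<phi>\<in>test_functions \<Omega>.
        (LINT x|lebesgue_on \<Omega>. u x *\<^sub>R gradient \<phi> x) = - (LINT x|lebesgue_on \<Omega>. \<phi> x *\<^sub>R g x))"

definition weak_grad ::
  "(real^'n) set \<Rightarrow> (real^'n \<Rightarrow> real) \<Rightarrow> real^'n \<Rightarrow> real^'n" where
  "weak_grad \<Omega> u = (SOME g. is_weak_grad \<Omega> u g)"

definition H1 :: "(real^'n) set \<Rightarrow> (real^'n \<Rightarrow> real) set" where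
  "H1 \<Omega> = {u \<in> L2 \<Omega> UNIV. \<exists>g. is_weak_grad \<Omega> u g}"

definition Hdiv :: "(real^'n) set \<Rightarrow> (real^'n \<Rightarrow> real^'n) set" where
  "Hdiv \<Omega> = {v \<in> L2 \<Omega> UNIV. \<exists>g. is_weak_div \<Omega> v g}"

definition Hdiv_norm :: "(real^'n) set \<Rightarrow> (real^'n \<Rightarrow> real^'n) \<Rightarrow> real" where
  "Hdiv_norm \<Omega> v = sqrt ((l2_norm \<Omega> v)\<^sup>2 + (l2_norm \<Omega> (weak_div \<Omega> v))\<^sup>2)"

text \<open>
  The normal trace \<open>v \<cdot> n\<close> of \<open>v \<in> H(div)\<close> is the functional on traces of \<open>H\<^sup>1\<close> functions given by
  Green's formula \<open>\<langle>v \<cdot> n, u\<rangle> = (v, \<nabla> u) + (div v, u)\<close>.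
\<close>

definition normal_trace ::
  "(real^'n) set \<Rightarrow> (real^'n \<Rightarrow> real^'n) \<Rightarrow> (real^'n \<Rightarrow> real) \<Rightarrow> real" where
  "normal_trace \<Omega> v u = l2_inner \<Omega> v (weak_grad \<Omega> u) + l2_inner \<Omega> (weak_div \<Omega> v) u"

definition H0div :: "(real^'n) set \<Rightarrow> (real^'n \<Rightarrow> real^'n) set" where
  "H0div \<Omega> = {v \<in> Hdiv \<Omega>. \<forall>u\<in>H1 \<Omega>. normal_trace \<Omega> v u = 0}"

subsection \<open>The dual of \<open>H\<^sub>0(div)\<close>\<close>

text \<open>
  Functionals are normalised to vanish outside \<open>H\<^sub>0(div)\<close>, so that equality in the dual
  space is equality of HOL functions.
\<close>

definition H0div_dual :: "(real^'n) set \<Rightarrow> ((real^'n \<Rightarrow> real^'n) \<Rightarrow> real) set" where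
  "H0div_dual \<Omega> = {F.
     (\<forall>u\<in>H0div \<Omega>. \<forall>v\<in>H0div \<Omega>. F (\<lambda>x. u x + v x) = F u + F v) \<and>
     (\<forall>c. \<forall>v\<in>H0div \<Omega>. F (\<lambda>x. c *\<^sub>R v x) = c * F v) \<and>
     (\<exists>K. \<forall>v\<in>H0div \<Omega>. \<bar>F v\<bar> \<le> K * Hdiv_norm \<Omega> v) \<and>
     (\<forall>v. v \<notin> H0div \<Omega> \<longrightarrow> F v = 0)}"

definition dual_norm :: "(real^'n) set \<Rightarrow> ((real^'n \<Rightarrow> real^'n) \<Rightarrow> real) \<Rightarrow> real" where
  "dual_norm \<Omega> F = Sup {\<bar>F v\<bar> |v. v \<in> H0div \<Omega> \<and> Hdiv_norm \<Omega> v \<le> 1}"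

definition dual_add ::
  "((real^'n \<Rightarrow> real^'n) \<Rightarrow> real) \<Rightarrow> ((real^'n \<Rightarrow> real^'n) \<Rightarrow> real) \<Rightarrow>
     (real^'n \<Rightarrow> real^'n) \<Rightarrow> real" where
  "dual_add F G = (\<lambda>v. F v + G v)"

definition dual_grad ::
  "(real^'n) set \<Rightarrow> (real^'n \<Rightarrow> real) \<Rightarrow> (real^'n \<Rightarrow> real^'n) \<Rightarrow> real" where
  "dual_grad \<Omega> q = (\<lambda>v. if v \<in> H0div \<Omega> then - l2_inner \<Omega> q (weak_div \<Omega> v) else 0)"

text \<open>
  The row-wise distributional divergence of \<open>\<tau>\<close> is \<open>\<langle>div \<tau>, \<phi>\<rangle> = - (\<tau>, \<nabla> \<phi>)\<close>, with the Jacobian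
  \<open>(\<nabla> \<phi>)\<^sub>i\<^sub>j = \<partial>\<^sub>j \<phi>\<^sub>i\<close> and the Frobenius inner product. Its bounded extension to \<open>H\<^sub>0(div)\<close> is unique
  because test functions are dense there.
\<close>

definition distr_div ::
  "(real^'n) set \<Rightarrow> (real^'n \<Rightarrow> real^'n^'n) \<Rightarrow> (real^'n \<Rightarrow> real^'n) \<Rightarrow> real" where
  "distr_div \<Omega> \<tau> \<phi> = - l2_inner \<Omega> \<tau> (\<lambda>x. jacobian \<phi> (at x))"

definition is_dual_div ::
  "(real^'n) set \<Rightarrow> (real^'n \<Rightarrow> real^'n^'n) \<Rightarrow> ((real^'n \<Rightarrow> real^'n) \<Rightarrow> real) \<Rightarrow> bool" where
  "is_dual_div \<Omega> \<tau> F \<longleftrightarrow>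
     F \<in> H0div_dual \<Omega> \<and> (\<forall>\<phi>\<in>test_functions \<Omega>. F \<phi> = distr_div \<Omega> \<tau> \<phi>)"

definition dual_div ::
  "(real^'n) set \<Rightarrow> (real^'n \<Rightarrow> real^'n^'n) \<Rightarrow> (real^'n \<Rightarrow> real^'n) \<Rightarrow> real" where
  "dual_div \<Omega> \<tau> = (THE F. is_dual_div \<Omega> \<tau> F)"

definition Hcurldiv :: "(real^'n) set \<Rightarrow> (real^'n \<Rightarrow> real^'n^'n) set" where
  "Hcurldiv \<Omega> = {\<tau> \<in> L2 \<Omega> sym_traceless. \<exists>F. is_dual_div \<Omega> \<tau> F}"

definition Hcurldiv_norm :: "(real^'n) set \<Rightarrow> (real^'n \<Rightarrow> real^'n^'n) \<Rightarrow> real" where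
  "Hcurldiv_norm \<Omega> \<tau> = sqrt ((l2_norm \<Omega> \<tau>)\<^sup>2 + (dual_norm \<Omega> (dual_div \<Omega> \<tau>))\<^sup>2)"

end

theory Submission imports Defs begin

text \<open>
  Write \<open>d \<phi> = (\<partial>\<^sub>1 \<phi>\<^sub>1, \<dots>, \<partial>\<^sub>n \<phi>\<^sub>n)\<close> for the diagonal of the Jacobian of a test field \<open>\<phi>\<close>, so that \<open>div \<phi>\<close> is
  the sum of the entries of \<open>d \<phi>\<close>. The whole decomposition comes from the estimate
  \<open>\<parallel>\<phi>\<parallel> \<le> 2 R \<parallel>d \<phi>\<parallel>\<close>, where \<open>\<Omega>\<close> lies in the ball of radius \<open>R\<close>: it is the one-dimensional Poincare
  inequality, applied to each component \<open>\<phi>\<^sub>i\<close> in its own direction \<open>e\<^sub>i\<close>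
  (\<open>Poincare_directional\<close>, \<open>l2_norm_le_diag_deriv\<close>). A functional \<open>w\<close> in the dual of \<open>H\<^sub>0(div)\<close> therefore
  satisfies \<open>\<bar>w \<phi>\<bar> \<le> c \<parallel>w\<parallel> \<parallel>d \<phi>\<parallel>\<close> on test fields, and the Riesz representation theorem for the
  functional \<open>d \<phi> \<mapsto> w \<phi>\<close> on a subspace of \<open>L\<^sup>2\<close> yields \<open>\<sigma>\<close> with \<open>w \<phi> = - (\<sigma>, d \<phi>)\<close> and
  \<open>\<parallel>\<sigma>\<parallel> \<le> c \<parallel>w\<parallel>\<close> (\<open>functional_diag_representation\<close>). Split the diagonal matrix with entries \<open>\<sigma>\<^sub>i\<close> into
  its traceless part \<open>\<tau>\<close> and the mean \<open>p\<close> of the \<open>\<sigma>\<^sub>i\<close> times the identity. Then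
  \<open>w \<phi> = - (\<tau>, \<nabla> \<phi>) - (p, div \<phi>)\<close>, that is, \<open>w = div \<tau> + \<nabla> p\<close> on test fields, and \<open>\<tau>\<close> is symmetric
  and traceless with \<open>\<parallel>\<tau>\<parallel> + \<parallel>p\<parallel>\<close> bounded by a multiple of \<open>\<parallel>w\<parallel>\<close>. Subtracting its mean value from
  \<open>p\<close> leaves \<open>\<nabla> p\<close> unchanged because the divergence of a test field integrates to zero. The bound on
  \<open>div \<tau> = w - \<nabla> p\<close> in the dual norm then follows from the triangle inequality (\<open>regular_decomposition\<close>).

  The identity extends from test fields to \<open>H\<^sub>0(div)\<close>, and \<open>div \<tau>\<close> is well defined, because a bounded
  functional \<open>F\<close> on \<open>H\<^sub>0(div)\<close> that vanishes on test fields is zero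
  (\<open>H0div_dual_eq_zero_if_test_zero\<close>). Indeed, by Riesz, \<open>F v = (f, v) + (g, div v)\<close>. Vanishing on test
  fields says that \<open>f\<close> is the weak gradient of \<open>g\<close>, so \<open>g \<in> H\<^sup>1\<close>, and then \<open>F v\<close> is the normal trace of
  \<open>v\<close> evaluated at \<open>g\<close>, which is zero by the definition of \<open>H\<^sub>0(div)\<close>.

  Three pieces of analysis support this: the completeness of \<open>L\<^sup>2\<close> and the Riesz theorem
  (\<open>L2_complete\<close>, \<open>L2_Riesz\<close>); the fundamental lemma of the calculus of variations, by which weak
  derivatives are unique almost everywhere (\<open>fundamental_lemma\<close>); and integration by parts
  for test functions, which reduces to the fact that a derivative of a test function has integral zero
  (\<open>integral_derivative_test_function\<close>).
\<close>

section \<open>The space \<open>L\<^sup>2\<close>\<close>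

lemma L2_UNIV_iff:
  "f \<in> L2 \<Omega> UNIV \<longleftrightarrow>
     f \<in> borel_measurable (lebesgue_on \<Omega>) \<and> integrable (lebesgue_on \<Omega>) (\<lambda>x. (norm (f x))\<^sup>2)"
  by (simp add: L2_def)

lemma L2_measurable [measurable_dest]:
  "f \<in> L2 \<Omega> X \<Longrightarrow> f \<in> borel_measurable (lebesgue_on \<Omega>)"
  by (simp add: L2_def)

lemma L2_dominated:
  assumes g: "g \<in> L2 \<Omega> UNIV" and f: "f \<in> borel_measurable (lebesgue_on \<Omega>)"
    and le: "AE x in lebesgue_on \<Omega>. norm (f x) \<le> c * norm (g x)"
  shows "f \<in> L2 \<Omega> UNIV"
  unfolding L2_UNIV_iff
proof (intro conjI f)
  show "integrable (lebesgue_on \<Omega>) (\<lambda>x. (norm (f x))\<^sup>2)"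
  proof (rule Bochner_Integration.integrable_bound)
    show "integrable (lebesgue_on \<Omega>) (\<lambda>x. c\<^sup>2 * (norm (g x))\<^sup>2)"
      using g by (simp add: L2_UNIV_iff)
    show "AE x in lebesgue_on \<Omega>. norm ((norm (f x))\<^sup>2) \<le> norm (c\<^sup>2 * (norm (g x))\<^sup>2)"
      using le
    proof eventually_elim
      case (elim x)
      then have "(norm (f x))\<^sup>2 \<le> (c * norm (g x))\<^sup>2"
        by (intro power_mono) auto
      then show ?case by (simp add: power_mult_distrib)
    qed
  qed (use f in measurable)
qed

lemma L2_inner_integrable:
  fixes f g :: "'a::euclidean_space \<Rightarrow> 'b::euclidean_space"
  assumes f: "f \<in> L2 \<Omega> UNIV" and g: "g \<in> L2 \<Omega> UNIV"
  shows "integrable (lebesgue_on \<Omega>) (\<lambda>x. f x \<bullet> g x)"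
proof (rule Bochner_Integration.integrable_bound)
  show "integrable (lebesgue_on \<Omega>) (\<lambda>x. (norm (f x))\<^sup>2 + (norm (g x))\<^sup>2)"
    using f g by (simp add: L2_UNIV_iff)
  have "norm (f x \<bullet> g x) \<le> (norm (f x))\<^sup>2 + (norm (g x))\<^sup>2" for x
  proof -
    have "\<bar>f x \<bullet> g x\<bar> \<le> norm (f x) * norm (g x)" by (rule Cauchy_Schwarz_ineq2)
    also have "\<dots> \<le> 2 * (norm (f x) * norm (g x))" by simp
    also have "\<dots> \<le> (norm (f x))\<^sup>2 + (norm (g x))\<^sup>2"
      using sum_squares_bound[of "norm (f x)" "norm (g x)"] by simp
    finally show ?thesis by simp
  qed
  then show "AE x in lebesgue_on \<Omega>. norm (f x \<bullet> g x) \<le> norm ((norm (f x))\<^sup>2 + (norm (g x))\<^sup>2)"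
    by (intro AE_I2) (metis abs_ge_self order_trans real_norm_def)
qed (use L2_measurable[OF f] L2_measurable[OF g] in measurable)

lemma L2_scaleR:
  fixes f :: "'a::euclidean_space \<Rightarrow> 'b::euclidean_space"
  assumes "f \<in> L2 \<Omega> UNIV" shows "(\<lambda>x. c *\<^sub>R f x) \<in> L2 \<Omega> UNIV"
  by (rule L2_dominated[OF assms, where c="\<bar>c\<bar>"]) (use L2_measurable[OF assms] in auto)

lemma L2_add:
  fixes f g :: "'a::euclidean_space \<Rightarrow> 'b::euclidean_space"
  assumes f: "f \<in> L2 \<Omega> UNIV" and g: "g \<in> L2 \<Omega> UNIV"
  shows "(\<lambda>x. f x + g x) \<in> L2 \<Omega> UNIV"
  unfolding L2_UNIV_iff
proof (intro conjI)
  have "integrable (lebesgue_on \<Omega>) (\<lambda>x. (norm (f x))\<^sup>2 + 2 * (f x \<bullet> g x) + (norm (g x))\<^sup>2)"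
    using f g L2_inner_integrable[OF f g] by (simp add: L2_UNIV_iff)
  then show "integrable (lebesgue_on \<Omega>) (\<lambda>x. (norm (f x + g x))\<^sup>2)"
    by (rule Bochner_Integration.integrable_cong[THEN iffD1, rotated 2])
      (auto simp: power2_norm_eq_inner inner_add_left inner_add_right inner_commute)
qed (use L2_measurable[OF f] L2_measurable[OF g] in measurable)

lemma L2_diff:
  fixes f g :: "'a::euclidean_space \<Rightarrow> 'b::euclidean_space"
  assumes "f \<in> L2 \<Omega> UNIV" and "g \<in> L2 \<Omega> UNIV"
  shows "(\<lambda>x. f x - g x) \<in> L2 \<Omega> UNIV"
  using L2_add[OF assms(1) L2_scaleR[OF assms(2), of "-1"]] by simp

lemma l2_inner_commute: "l2_inner \<Omega> f g = l2_inner \<Omega> g f"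
  by (simp add: l2_inner_def inner_commute)

lemma l2_inner_add_left:
  fixes f g h :: "'a::euclidean_space \<Rightarrow> 'b::euclidean_space"
  assumes "f \<in> L2 \<Omega> UNIV" "g \<in> L2 \<Omega> UNIV" "h \<in> L2 \<Omega> UNIV"
  shows "l2_inner \<Omega> (\<lambda>x. f x + g x) h = l2_inner \<Omega> f h + l2_inner \<Omega> g h"
  using assms by (simp add: l2_inner_def inner_add_left L2_inner_integrable)

lemma l2_inner_diff_left:
  fixes f g h :: "'a::euclidean_space \<Rightarrow> 'b::euclidean_space"
  assumes "f \<in> L2 \<Omega> UNIV" "g \<in> L2 \<Omega> UNIV" "h \<in> L2 \<Omega> UNIV"
  shows "l2_inner \<Omega> (\<lambda>x. f x - g x) h = l2_inner \<Omega> f h - l2_inner \<Omega> g h"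
  using assms by (simp add: l2_inner_def inner_diff_left L2_inner_integrable)

lemma l2_inner_scaleR_left: "l2_inner \<Omega> (\<lambda>x. c *\<^sub>R f x) g = c * l2_inner \<Omega> f g"
  by (simp add: l2_inner_def)

lemma l2_inner_scaleR_right: "l2_inner \<Omega> f (\<lambda>x. c *\<^sub>R g x) = c * l2_inner \<Omega> f g"
  by (simp add: l2_inner_def)

lemma l2_inner_add_right:
  fixes f g h :: "'a::euclidean_space \<Rightarrow> 'b::euclidean_space"
  assumes "f \<in> L2 \<Omega> UNIV" "g \<in> L2 \<Omega> UNIV" "h \<in> L2 \<Omega> UNIV"
  shows "l2_inner \<Omega> h (\<lambda>x. f x + g x) = l2_inner \<Omega> h f + l2_inner \<Omega> h g"
  using l2_inner_add_left[OF assms] by (simp add: l2_inner_commute)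

lemma l2_inner_cong_AE:
  fixes f f' g g' :: "'a::euclidean_space \<Rightarrow> 'b::euclidean_space"
  assumes "AE x in lebesgue_on \<Omega>. f x = f' x" "AE x in lebesgue_on \<Omega>. g x = g' x"
    "f \<in> L2 \<Omega> UNIV" "f' \<in> L2 \<Omega> UNIV" "g \<in> L2 \<Omega> UNIV" "g' \<in> L2 \<Omega> UNIV"
  shows "l2_inner \<Omega> f g = l2_inner \<Omega> f' g'"
  unfolding l2_inner_def
proof (rule integral_cong_AE)
  show "AE x in lebesgue_on \<Omega>. f x \<bullet> g x = f' x \<bullet> g' x"
    using assms(1,2) by eventually_elim simp
qed (use assms(3-6)[THEN L2_measurable] in auto)

lemma l2_inner_self_nonneg: "0 \<le> l2_inner \<Omega> f f"
  by (simp add: l2_inner_def)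

lemma l2_norm_nonneg [simp]: "0 \<le> l2_norm \<Omega> f"
  by (simp add: l2_norm_def l2_inner_self_nonneg)

lemma l2_norm_power2: "(l2_norm \<Omega> f)\<^sup>2 = l2_inner \<Omega> f f"
  by (simp add: l2_norm_def l2_inner_self_nonneg)

lemma l2_norm_cong_AE:
  fixes f g :: "'a::euclidean_space \<Rightarrow> 'b::euclidean_space"
  assumes "AE x in lebesgue_on \<Omega>. f x = g x" "f \<in> L2 \<Omega> UNIV" "g \<in> L2 \<Omega> UNIV"
  shows "l2_norm \<Omega> f = l2_norm \<Omega> g"
  using assms l2_inner_cong_AE[of f g \<Omega> f g] by (simp add: l2_norm_def)

lemma l2_norm_scaleR: "l2_norm \<Omega> (\<lambda>x. c *\<^sub>R f x) = \<bar>c\<bar> * l2_norm \<Omega> f"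
  by (simp add: l2_norm_def l2_inner_scaleR_left l2_inner_scaleR_right real_sqrt_mult
      flip: mult.assoc power2_eq_square)

lemma l2_norm_power2_diff:
  fixes f g :: "'a::euclidean_space \<Rightarrow> 'b::euclidean_space"
  assumes "f \<in> L2 \<Omega> UNIV" "g \<in> L2 \<Omega> UNIV"
  shows "(l2_norm \<Omega> (\<lambda>x. f x - g x))\<^sup>2 = (l2_norm \<Omega> f)\<^sup>2 - 2 * l2_inner \<Omega> f g + (l2_norm \<Omega> g)\<^sup>2"
proof -
  have "l2_inner \<Omega> (\<lambda>x. f x - g x) (\<lambda>x. f x - g x)
      = l2_inner \<Omega> f (\<lambda>x. f x - g x) - l2_inner \<Omega> g (\<lambda>x. f x - g x)"
    using assms by (simp add: l2_inner_diff_left L2_diff)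
  also have "\<dots> = l2_inner \<Omega> (\<lambda>x. f x - g x) f - l2_inner \<Omega> (\<lambda>x. f x - g x) g"
    by (simp add: l2_inner_commute)
  also have "\<dots> = l2_inner \<Omega> f f - 2 * l2_inner \<Omega> f g + l2_inner \<Omega> g g"
    using assms by (simp add: l2_inner_diff_left l2_inner_commute[of \<Omega> g f])
  finally show ?thesis by (simp add: l2_norm_power2)
qed

lemma l2_norm_mono:
  assumes g: "g \<in> L2 \<Omega> UNIV" and f: "f \<in> borel_measurable (lebesgue_on \<Omega>)"
    and le: "AE x in lebesgue_on \<Omega>. norm (f x) \<le> c * norm (g x)" and "0 \<le> c"
  shows "l2_norm \<Omega> f \<le> c * l2_norm \<Omega> g"
proof (rule power2_le_imp_le)
  have fL2: "f \<in> L2 \<Omega> UNIV" by (rule L2_dominated[OF g f le])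
  have "(LINT x|lebesgue_on \<Omega>. (norm (f x))\<^sup>2) \<le> (LINT x|lebesgue_on \<Omega>. c\<^sup>2 * (norm (g x))\<^sup>2)"
  proof (rule integral_mono_AE)
    show "AE x in lebesgue_on \<Omega>. (norm (f x))\<^sup>2 \<le> c\<^sup>2 * (norm (g x))\<^sup>2"
      using le
    proof eventually_elim
      case (elim x)
      then have "(norm (f x))\<^sup>2 \<le> (c * norm (g x))\<^sup>2"
        by (intro power_mono) auto
      then show ?case by (simp add: power_mult_distrib)
    qed
  qed (use fL2 g in \<open>auto simp: L2_UNIV_iff\<close>)
  then show "(l2_norm \<Omega> f)\<^sup>2 \<le> (c * l2_norm \<Omega> g)\<^sup>2"
    by (simp add: power_mult_distrib l2_norm_power2 l2_inner_def dot_square_norm)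
qed (use \<open>0 \<le> c\<close> in auto)

text \<open>
  The quadratic polynomial \<open>t \<mapsto> \<parallel>f - t g\<parallel>\<^sup>2\<close> is nonnegative, so evaluating it at its minimum gives the
  claim; if \<open>\<parallel>g\<parallel> = 0\<close> it is affine in \<open>t\<close> and hence constant.
\<close>

lemma l2_Cauchy_Schwarz:
  fixes f g :: "'a::euclidean_space \<Rightarrow> 'b::euclidean_space"
  assumes f: "f \<in> L2 \<Omega> UNIV" and g: "g \<in> L2 \<Omega> UNIV"
  shows "\<bar>l2_inner \<Omega> f g\<bar> \<le> l2_norm \<Omega> f * l2_norm \<Omega> g"
proof -
  have *: "0 \<le> (l2_norm \<Omega> g)\<^sup>2 * t\<^sup>2 + - 2 * l2_inner \<Omega> f g * t + (l2_norm \<Omega> f)\<^sup>2" for t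
  proof -
    have "0 \<le> (l2_norm \<Omega> (\<lambda>x. f x - t *\<^sub>R g x))\<^sup>2" by simp
    also have "\<dots> = (l2_norm \<Omega> f)\<^sup>2 - 2 * t * l2_inner \<Omega> f g + t\<^sup>2 * (l2_norm \<Omega> g)\<^sup>2"
      using l2_norm_power2_diff[OF f L2_scaleR[OF g, of t]]
      by (simp add: l2_norm_scaleR l2_inner_scaleR_right power_mult_distrib)
    finally show ?thesis by (simp add: algebra_simps)
  qed
  have "(l2_inner \<Omega> f g)\<^sup>2 \<le> (l2_norm \<Omega> f)\<^sup>2 * (l2_norm \<Omega> g)\<^sup>2"
  proof (cases "l2_norm \<Omega> g = 0")
    case True
    have "l2_inner \<Omega> f g = 0"
    proof (rule ccontr)
      assume "l2_inner \<Omega> f g \<noteq> 0"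
      then have "0 \<le> - 2 * l2_inner \<Omega> f g * (((l2_norm \<Omega> f)\<^sup>2 + 1) / (2 * l2_inner \<Omega> f g)) + (l2_norm \<Omega> f)\<^sup>2"
        using *[of "((l2_norm \<Omega> f)\<^sup>2 + 1) / (2 * l2_inner \<Omega> f g)"] True by simp
      with \<open>l2_inner \<Omega> f g \<noteq> 0\<close> show False by (simp add: field_simps)
    qed
    then show ?thesis by simp
  next
    case False
    then have pos: "0 < (l2_norm \<Omega> g)\<^sup>2" by simp
    have "0 \<le> (l2_norm \<Omega> f)\<^sup>2 - (l2_inner \<Omega> f g)\<^sup>2 / (l2_norm \<Omega> g)\<^sup>2"
      using *[of "l2_inner \<Omega> f g / (l2_norm \<Omega> g)\<^sup>2"] False
      by (simp add: field_simps power2_eq_square)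
    with pos show ?thesis by (simp add: field_simps)
  qed
  then show ?thesis
    by (metis abs_le_square_iff abs_mult abs_of_nonneg l2_norm_nonneg power_mult_distrib)
qed

lemma l2_norm_triangle:
  fixes f g :: "'a::euclidean_space \<Rightarrow> 'b::euclidean_space"
  assumes f: "f \<in> L2 \<Omega> UNIV" and g: "g \<in> L2 \<Omega> UNIV"
  shows "l2_norm \<Omega> f \<le> l2_norm \<Omega> g + l2_norm \<Omega> (\<lambda>x. f x - g x)"
proof (rule power2_le_imp_le)
  have d: "(\<lambda>x. f x - g x) \<in> L2 \<Omega> UNIV" using f g by (rule L2_diff)
  have "(l2_norm \<Omega> f)\<^sup>2 = (l2_norm \<Omega> g)\<^sup>2 + 2 * l2_inner \<Omega> g (\<lambda>x. f x - g x) + (l2_norm \<Omega> (\<lambda>x. f x - g x))\<^sup>2"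
    using l2_norm_power2_diff[OF f g] l2_inner_diff_left[OF f g g]
    by (simp add: l2_norm_power2 l2_inner_commute)
  also have "\<dots> \<le> (l2_norm \<Omega> g + l2_norm \<Omega> (\<lambda>x. f x - g x))\<^sup>2"
    using l2_Cauchy_Schwarz[OF g d] by (simp add: power2_sum)
  finally show "(l2_norm \<Omega> f)\<^sup>2 \<le> (l2_norm \<Omega> g + l2_norm \<Omega> (\<lambda>x. f x - g x))\<^sup>2" .
qed auto

lemma L2_const: "\<Omega> \<in> lmeasurable \<Longrightarrow> (\<lambda>x. c) \<in> L2 \<Omega> UNIV"
  using finite_measure.integrable_const[OF finite_measure_lebesgue_on]
  by (auto simp: L2_UNIV_iff)

lemma L2_integrable:
  fixes f :: "'a::euclidean_space \<Rightarrow> 'b::euclidean_space"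
  assumes "\<Omega> \<in> lmeasurable" "f \<in> L2 \<Omega> UNIV"
  shows "integrable (lebesgue_on \<Omega>) f"
proof (rule Bochner_Integration.integrable_bound)
  show "integrable (lebesgue_on \<Omega>) (\<lambda>x. 1 + (norm (f x))\<^sup>2)"
    using assms(2) finite_measure.integrable_const[OF finite_measure_lebesgue_on[OF assms(1)]]
    by (intro Bochner_Integration.integrable_add) (auto simp: L2_UNIV_iff)
  have "norm (f x) \<le> 1 + (norm (f x))\<^sup>2" for x
    using sum_squares_bound[of "norm (f x)" 1] norm_ge_zero[of "f x"] by (simp, linarith)
  then show "AE x in lebesgue_on \<Omega>. norm (f x) \<le> norm (1 + (norm (f x))\<^sup>2)"
    by (intro AE_I2) (metis abs_ge_self order_trans real_norm_def)
qed (use L2_measurable[OF assms(2)] in auto)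

text \<open>
  On a domain of finite measure, Cauchy--Schwarz against the constant one makes convergence in
  \<open>L\<^sup>2\<close> imply convergence in \<open>L\<^sup>1\<close>. This gives access to almost everywhere convergent subsequences.
\<close>

lemma L1_le_l2_norm:
  fixes f :: "'a::euclidean_space \<Rightarrow> 'b::euclidean_space"
  assumes "\<Omega> \<in> lmeasurable" "f \<in> L2 \<Omega> UNIV"
  shows "(LINT x|lebesgue_on \<Omega>. norm (f x)) \<le> sqrt (measure lebesgue \<Omega>) * l2_norm \<Omega> f"
proof -
  have nf: "(\<lambda>x. norm (f x)) \<in> L2 \<Omega> UNIV"
    using assms by (auto simp: L2_UNIV_iff)
  have one: "(\<lambda>x. 1::real) \<in> L2 \<Omega> UNIV"
    using assms(1) by (rule L2_const)
  have "l2_norm \<Omega> (\<lambda>x. norm (f x)) = l2_norm \<Omega> f"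
    by (simp add: l2_norm_def l2_inner_def dot_square_norm power2_eq_square)
  moreover have "l2_norm \<Omega> (\<lambda>x. 1::real) = sqrt (measure lebesgue \<Omega>)"
    using assms(1) by (simp add: l2_norm_def l2_inner_def measure_restrict_space fmeasurableD)
  ultimately show ?thesis
    using l2_Cauchy_Schwarz[OF one nf] by (simp add: l2_inner_def)
qed

section \<open>Completeness and Riesz representation\<close>

text \<open>
  Riesz--Fischer. A Cauchy sequence in \<open>L\<^sup>2\<close> is Cauchy in \<open>L\<^sup>1\<close>, so a subsequence has a limit \<open>g\<close> almost
  everywhere; Fatou's lemma along this subsequence bounds \<open>\<parallel>f\<^sub>n - g\<parallel>\<close> by the tail of the Cauchy condition.
\<close>

lemma L2_complete:
  fixes f :: "nat \<Rightarrow> 'a::euclidean_space \<Rightarrow> 'b::euclidean_space"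
  assumes \<Omega>: "\<Omega> \<in> lmeasurable" and f: "\<And>n. f n \<in> L2 \<Omega> UNIV"
    and Cauchy: "\<And>e. 0 < e \<Longrightarrow> \<exists>N. \<forall>i\<ge>N. \<forall>j\<ge>N. l2_norm \<Omega> (\<lambda>x. f i x - f j x) < e"
  obtains g where "g \<in> L2 \<Omega> UNIV" "(\<lambda>n. l2_norm \<Omega> (\<lambda>x. f n x - g x)) \<longlonglongrightarrow> 0"
proof -
  let ?M = "lebesgue_on \<Omega>"
  note [measurable] = L2_measurable[OF f]
  define c where "c = sqrt (measure lebesgue \<Omega>) + 1"
  have c: "0 < c" by (simp add: c_def add_nonneg_pos)
  have "\<exists>N. \<forall>i\<ge>N. \<forall>j\<ge>N. (LINT x|?M. norm (f i x - f j x)) < e" if "0 < e" for e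
  proof -
    obtain N where N: "\<And>i j. i \<ge> N \<Longrightarrow> j \<ge> N \<Longrightarrow> l2_norm \<Omega> (\<lambda>x. f i x - f j x) < e / c"
      using Cauchy[of "e / c"] \<open>0 < e\<close> c by auto
    have "(LINT x|?M. norm (f i x - f j x)) < e" if "i \<ge> N" "j \<ge> N" for i j
    proof -
      have "(LINT x|?M. norm (f i x - f j x))
          \<le> sqrt (measure lebesgue \<Omega>) * l2_norm \<Omega> (\<lambda>x. f i x - f j x)"
        by (intro L1_le_l2_norm \<Omega> L2_diff f)
      also have "\<dots> \<le> c * l2_norm \<Omega> (\<lambda>x. f i x - f j x)"
        by (intro mult_right_mono) (auto simp: c_def)
      also have "\<dots> < e"
        using N[OF that] c by (simp add: field_simps)
      finally show ?thesis .
    qed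
    then show ?thesis by blast
  qed
  then obtain r where r: "strict_mono r" and ae: "AE x in ?M. Cauchy (\<lambda>i. f (r i) x)"
    using cauchy_L1_AE_cauchy_subseq[of ?M f] L2_integrable[OF \<Omega> f] by blast
  define g where "g x = lim (\<lambda>i. f (r i) x)" for x
  have g_meas [measurable]: "g \<in> borel_measurable ?M"
    unfolding g_def by (rule borel_measurable_lim_metric) simp
  have lim: "AE x in ?M. (\<lambda>i. f (r i) x) \<longlonglongrightarrow> g x"
    using ae by eventually_elim (simp add: g_def Cauchy_convergent_iff convergent_LIMSEQ_iff)
  have close: "(\<lambda>x. f n x - g x) \<in> L2 \<Omega> UNIV \<and> l2_norm \<Omega> (\<lambda>x. f n x - g x) \<le> e"
    if e: "0 < e" and N: "\<And>i. i \<ge> N \<Longrightarrow> l2_norm \<Omega> (\<lambda>x. f i x - f n x) < e" for n N e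
  proof -
    let ?h = "\<lambda>i x. ennreal ((norm (f (r i) x - f n x))\<^sup>2)"
    have int: "integrable ?M (\<lambda>x. (norm (f i x - f n x))\<^sup>2)" for i
      using L2_diff[OF f[of i] f[of n]] by (simp add: L2_UNIV_iff)
    have "(\<integral>\<^sup>+x. ennreal ((norm (f n x - g x))\<^sup>2) \<partial>?M) = (\<integral>\<^sup>+x. liminf (\<lambda>i. ?h i x) \<partial>?M)"
    proof (rule nn_integral_cong_AE)
      show "AE x in ?M. ennreal ((norm (f n x - g x))\<^sup>2) = liminf (\<lambda>i. ?h i x)"
        using lim
      proof eventually_elim
        case (elim x)
        have "(\<lambda>i. ?h i x) \<longlonglongrightarrow> ennreal ((norm (g x - f n x))\<^sup>2)"
          by (intro tendsto_ennrealI tendsto_intros elim)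
        then show ?case
          unfolding norm_minus_commute[of "f n x" "g x"] by (metis lim_imp_Liminf trivial_limit_sequentially)
      qed
    qed
    also have "\<dots> \<le> liminf (\<lambda>i. \<integral>\<^sup>+x. ?h i x \<partial>?M)"
      by (rule nn_integral_liminf) simp
    also have "\<dots> \<le> limsup (\<lambda>i. \<integral>\<^sup>+x. ?h i x \<partial>?M)"
      by (rule Liminf_le_Limsup) simp
    also have "\<dots> \<le> ennreal (e\<^sup>2)"
    proof (rule Limsup_bounded)
      have "(\<integral>\<^sup>+x. ?h i x \<partial>?M) \<le> ennreal (e\<^sup>2)" if "i \<ge> N" for i
      proof -
        have "(\<integral>\<^sup>+x. ?h i x \<partial>?M) = ennreal (LINT x|?M. (norm (f (r i) x - f n x))\<^sup>2)"
          by (rule nn_integral_eq_integral[OF int]) simp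
        also have "\<dots> = ennreal ((l2_norm \<Omega> (\<lambda>x. f (r i) x - f n x))\<^sup>2)"
          by (simp add: l2_norm_power2 l2_inner_def dot_square_norm)
        also have "\<dots> \<le> ennreal (e\<^sup>2)"
          using N[of "r i"] seq_suble[OF r, of i] that
          by (intro ennreal_leI power_mono) (auto intro: less_imp_le)
        finally show ?thesis .
      qed
      then show "\<forall>\<^sub>F i in sequentially. (\<integral>\<^sup>+x. ?h i x \<partial>?M) \<le> ennreal (e\<^sup>2)"
        by (auto simp: eventually_sequentially)
    qed
    finally have le: "(\<integral>\<^sup>+x. ennreal ((norm (f n x - g x))\<^sup>2) \<partial>?M) \<le> ennreal (e\<^sup>2)" .
    then have "integrable ?M (\<lambda>x. (norm (f n x - g x))\<^sup>2)"
      by (intro integrableI_bounded) (auto simp: less_top[symmetric] top_unique)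
    then have L2: "(\<lambda>x. f n x - g x) \<in> L2 \<Omega> UNIV"
      by (simp add: L2_UNIV_iff)
    have "ennreal ((l2_norm \<Omega> (\<lambda>x. f n x - g x))\<^sup>2) = (\<integral>\<^sup>+x. ennreal ((norm (f n x - g x))\<^sup>2) \<partial>?M)"
      using L2 by (subst nn_integral_eq_integral)
        (auto simp: L2_UNIV_iff l2_norm_power2 l2_inner_def dot_square_norm)
    with le have "(l2_norm \<Omega> (\<lambda>x. f n x - g x))\<^sup>2 \<le> e\<^sup>2"
      by (metis ennreal_le_iff zero_le_power2)
    then have "l2_norm \<Omega> (\<lambda>x. f n x - g x) \<le> e"
      by (rule power2_le_imp_le) (use e in simp)
    with L2 show ?thesis by simp
  qed
  show ?thesis
  proof
    obtain N where "\<And>i j. i \<ge> N \<Longrightarrow> j \<ge> N \<Longrightarrow> l2_norm \<Omega> (\<lambda>x. f i x - f j x) < 1"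
      using Cauchy[of 1] by auto
    then have "(\<lambda>x. f N x - g x) \<in> L2 \<Omega> UNIV"
      using close[of 1 N N] by simp
    from L2_diff[OF f[of N] this] show "g \<in> L2 \<Omega> UNIV" by simp
  next
    show "(\<lambda>n. l2_norm \<Omega> (\<lambda>x. f n x - g x)) \<longlonglongrightarrow> 0"
    proof (rule LIMSEQ_I)
      fix e :: real assume e: "0 < e"
      then obtain N where N: "\<And>i j. i \<ge> N \<Longrightarrow> j \<ge> N \<Longrightarrow> l2_norm \<Omega> (\<lambda>x. f i x - f j x) < e / 2"
        using Cauchy[of "e / 2"] by auto
      have "l2_norm \<Omega> (\<lambda>x. f n x - g x) \<le> e / 2" if "n \<ge> N" for n
        using close[of "e / 2" N n] e N[OF _ that] by simp
      then show "\<exists>N. \<forall>n\<ge>N. norm (l2_norm \<Omega> (\<lambda>x. f n x - g x) - 0) < e"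
        using e by (intro exI[of _ N]) (auto intro: le_less_trans[of _ "e / 2"] simp del: le_divide_eq_numeral1)
    qed
  qed
qed

text \<open>
  The functional is given through a family \<open>T\<close> of representatives, indexed by an arbitrary set on
  which linear combinations exist up to null sets: elements of \<open>H\<^sub>0(div)\<close> are mapped to pairs
  \<open>(v, div v)\<close>, and the weak divergence is linear only almost everywhere.

  The representing function is the limit of a minimising sequence for
  \<open>J i = \<parallel>T i\<parallel>\<^sup>2 - 2 l i\<close>. The parallelogram law makes every such sequence Cauchy, and the first-order
  condition at the limit is the representation of \<open>l\<close>. Since the limit \<open>g\<close> lies in the closure of the
  range of \<open>T\<close>, the bound on \<open>l\<close> passes to \<open>\<parallel>g\<parallel>\<^sup>2 \<le> K \<parallel>g\<parallel>\<close>.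
\<close>

lemma L2_Riesz:
  fixes T :: "'i \<Rightarrow> 'a::euclidean_space \<Rightarrow> 'b::euclidean_space" and l :: "'i \<Rightarrow> real"
  assumes \<Omega>: "\<Omega> \<in> lmeasurable" and "S \<noteq> {}"
    and T: "\<And>i. i \<in> S \<Longrightarrow> T i \<in> L2 \<Omega> UNIV"
    and linear: "\<And>i j a b. i \<in> S \<Longrightarrow> j \<in> S \<Longrightarrow>
      \<exists>k\<in>S. l k = a * l i + b * l j \<and> (AE x in lebesgue_on \<Omega>. T k x = a *\<^sub>R T i x + b *\<^sub>R T j x)"
    and bound: "\<And>i. i \<in> S \<Longrightarrow> \<bar>l i\<bar> \<le> K * l2_norm \<Omega> (T i)"
    and "0 \<le> K"
  obtains g where "g \<in> L2 \<Omega> UNIV" "l2_norm \<Omega> g \<le> K" "\<And>i. i \<in> S \<Longrightarrow> l i = l2_inner \<Omega> g (T i)"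
proof -
  define J where "J i = (l2_norm \<Omega> (T i))\<^sup>2 - 2 * l i" for i
  define m where "m = Inf (J ` S)"
  have "- K\<^sup>2 \<le> J i" if "i \<in> S" for i
  proof -
    have "0 \<le> (l2_norm \<Omega> (T i) - K)\<^sup>2" by simp
    then show ?thesis
      using bound[OF that] by (simp add: J_def power2_diff abs_le_iff algebra_simps)
  qed
  then have bdd: "bdd_below (J ` S)" by (auto intro!: bdd_belowI2)
  then have m_le: "m \<le> J i" if "i \<in> S" for i
    unfolding m_def using that by (rule cINF_lower)
  have m_le_comb: "m \<le> a\<^sup>2 * (l2_norm \<Omega> (T i))\<^sup>2 + 2 * a * b * l2_inner \<Omega> (T i) (T j)
      + b\<^sup>2 * (l2_norm \<Omega> (T j))\<^sup>2 - 2 * (a * l i + b * l j)" if ij: "i \<in> S" "j \<in> S" for i j a b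
  proof -
    obtain k where k: "k \<in> S" "l k = a * l i + b * l j"
      and ae: "AE x in lebesgue_on \<Omega>. T k x = a *\<^sub>R T i x + b *\<^sub>R T j x"
      using linear[OF ij] by blast
    have Ti: "(\<lambda>x. a *\<^sub>R T i x) \<in> L2 \<Omega> UNIV" and Tj: "(\<lambda>x. (-b) *\<^sub>R T j x) \<in> L2 \<Omega> UNIV"
      using T ij by (auto intro: L2_scaleR simp del: scaleR_minus_left)
    have "l2_norm \<Omega> (T k) = l2_norm \<Omega> (\<lambda>x. a *\<^sub>R T i x - (-b) *\<^sub>R T j x)"
      using ae k T Ti Tj by (intro l2_norm_cong_AE L2_diff) auto
    then have "(l2_norm \<Omega> (T k))\<^sup>2 = a\<^sup>2 * (l2_norm \<Omega> (T i))\<^sup>2 + 2 * a * b * l2_inner \<Omega> (T i) (T j)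
      + b\<^sup>2 * (l2_norm \<Omega> (T j))\<^sup>2"
      unfolding l2_norm_power2_diff[OF Ti Tj] \<open>l2_norm \<Omega> (T k) = _\<close>
      by (simp add: l2_norm_scaleR l2_inner_scaleR_left l2_inner_scaleR_right power_mult_distrib
          del: scaleR_minus_left)
    with m_le[OF k(1)] k(2) show ?thesis by (simp add: J_def)
  qed
  have "\<exists>i\<in>S. J i < m + inverse (real (Suc n))" for n
  proof (rule ccontr)
    assume "\<not> ?thesis"
    then have "m + inverse (real (Suc n)) \<le> m"
      unfolding m_def using \<open>S \<noteq> {}\<close> by (intro cINF_greatest) (auto simp: not_less)
    then show False by simp
  qed
  then obtain s where s: "\<And>n. s n \<in> S" and Js: "\<And>n. J (s n) < m + inverse (real (Suc n))"
    by metis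
  have Js_lim: "(\<lambda>n. J (s n)) \<longlonglongrightarrow> m"
  proof (rule real_tendsto_sandwich[where f="\<lambda>_. m"])
    show "(\<lambda>n. m + inverse (real (Suc n))) \<longlonglongrightarrow> m"
      using tendsto_add[OF tendsto_const[of m] LIMSEQ_inverse_real_of_nat] by simp
  qed (use m_le[OF s] less_imp_le[OF Js] in auto)
  \<comment> \<open>The parallelogram law, with \<open>J \<ge> m\<close> at the midpoint of \<open>i\<close> and \<open>j\<close>.\<close>
  have Cauchy_bound: "(l2_norm \<Omega> (\<lambda>x. T i x - T j x))\<^sup>2 \<le> 2 * (J i - m) + 2 * (J j - m)"
    if "i \<in> S" "j \<in> S" for i j
    using m_le_comb[OF that, of "1/2" "1/2"] l2_norm_power2_diff[OF T[OF that(1)] T[OF that(2)]]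
    by (simp add: J_def power2_eq_square algebra_simps)
  have "\<exists>N. \<forall>i\<ge>N. \<forall>j\<ge>N. l2_norm \<Omega> (\<lambda>x. T (s i) x - T (s j) x) < e" if "0 < e" for e
  proof -
    have "\<forall>\<^sub>F n in sequentially. J (s n) < m + e\<^sup>2 / 4"
      using Js_lim that by (intro order_tendstoD) auto
    then obtain N where N: "\<And>n. n \<ge> N \<Longrightarrow> J (s n) < m + e\<^sup>2 / 4"
      by (auto simp: eventually_sequentially)
    have arith: "X < q" if "X \<le> 2 * (a - m) + 2 * (b - m)" "a < m + q / 4" "b < m + q / 4"
      for X a b q :: real using that by (simp add: field_simps)
    have "l2_norm \<Omega> (\<lambda>x. T (s i) x - T (s j) x) < e" if "i \<ge> N" "j \<ge> N" for i j
    proof (rule power2_less_imp_less)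
      show "(l2_norm \<Omega> (\<lambda>x. T (s i) x - T (s j) x))\<^sup>2 < e\<^sup>2"
        using that by (intro arith[OF Cauchy_bound[OF s s]] N)
    qed (use \<open>0 < e\<close> in simp)
    then show ?thesis by blast
  qed
  then obtain g where g: "g \<in> L2 \<Omega> UNIV"
    and lim: "(\<lambda>n. l2_norm \<Omega> (\<lambda>x. T (s n) x - g x)) \<longlonglongrightarrow> 0"
    using L2_complete[OF \<Omega>, of "\<lambda>n. T (s n)"] T[OF s] by blast
  have inner_lim: "(\<lambda>n. l2_inner \<Omega> (T (s n)) h) \<longlonglongrightarrow> l2_inner \<Omega> g h" if h: "h \<in> L2 \<Omega> UNIV" for h
  proof -
    have "(\<lambda>n. l2_inner \<Omega> (\<lambda>x. T (s n) x - g x) h) \<longlonglongrightarrow> 0"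
    proof (rule Lim_null_comparison)
      show "(\<lambda>n. l2_norm \<Omega> (\<lambda>x. T (s n) x - g x) * l2_norm \<Omega> h) \<longlonglongrightarrow> 0"
        using tendsto_mult_right[OF lim] by simp
      show "\<forall>\<^sub>F n in sequentially. norm (l2_inner \<Omega> (\<lambda>x. T (s n) x - g x) h)
          \<le> l2_norm \<Omega> (\<lambda>x. T (s n) x - g x) * l2_norm \<Omega> h"
        using l2_Cauchy_Schwarz[OF L2_diff[OF T[OF s] g] h] by auto
    qed
    then have "(\<lambda>n. l2_inner \<Omega> (T (s n)) h - l2_inner \<Omega> g h) \<longlonglongrightarrow> 0"
      using l2_inner_diff_left[OF T[OF s] g h] by simp
    then show ?thesis by (simp add: LIM_zero_iff)
  qed
  have repr: "l j = l2_inner \<Omega> g (T j)" if j: "j \<in> S" for j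
  proof -
    define A where "A = l2_inner \<Omega> g (T j) - l j"
    define B where "B = (l2_norm \<Omega> (T j))\<^sup>2"
    have "0 \<le> 2 * c * A + c\<^sup>2 * B" for c
    proof -
      have "m \<le> J (s n) + 2 * c * (l2_inner \<Omega> (T (s n)) (T j) - l j) + c\<^sup>2 * B" for n
        using m_le_comb[OF s j, of 1 n c] by (simp add: J_def B_def algebra_simps)
      moreover have "(\<lambda>n. J (s n) + 2 * c * (l2_inner \<Omega> (T (s n)) (T j) - l j) + c\<^sup>2 * B)
          \<longlonglongrightarrow> m + 2 * c * A + c\<^sup>2 * B"
        unfolding A_def by (intro tendsto_intros Js_lim inner_lim T j)
      ultimately have "m \<le> m + 2 * c * A + c\<^sup>2 * B"
        by (intro LIMSEQ_le_const) auto
      then show ?thesis by simp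
    qed
    \<comment> \<open>Near the minimiser \<open>- A / B\<close> of the polynomial; the denominator \<open>B + 1\<close> keeps it defined for \<open>B = 0\<close>.\<close>
    from this[of "- A / (B + 1)"] have "A = 0"
    proof -
      have B: "0 \<le> B" by (simp add: B_def)
      have "2 * (- A / (B + 1)) * A + (- A / (B + 1))\<^sup>2 * B = - (A\<^sup>2 * (B + 2)) / (B + 1)\<^sup>2"
        using B by (simp add: field_simps power2_eq_square add_nonneg_eq_0_iff)
      with \<open>0 \<le> 2 * (- A / (B + 1)) * A + (- A / (B + 1))\<^sup>2 * B\<close>
      have "A\<^sup>2 * (B + 2) / (B + 1)\<^sup>2 \<le> 0" by simp
      then have "A\<^sup>2 * (B + 2) \<le> 0" using B by (simp add: divide_le_0_iff)
      with B show "A = 0" by (simp add: mult_le_0_iff)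
    qed
    then show ?thesis by (simp add: A_def)
  qed
  have "l2_norm \<Omega> g \<le> K"
  proof -
    have "(l2_norm \<Omega> g)\<^sup>2 \<le> K * (l2_norm \<Omega> g + 0)"
    proof (rule LIMSEQ_le)
      show "(\<lambda>n. l2_inner \<Omega> (T (s n)) g) \<longlonglongrightarrow> (l2_norm \<Omega> g)\<^sup>2"
        unfolding l2_norm_power2 by (rule inner_lim[OF g])
      show "(\<lambda>n. K * (l2_norm \<Omega> g + l2_norm \<Omega> (\<lambda>x. T (s n) x - g x))) \<longlonglongrightarrow> K * (l2_norm \<Omega> g + 0)"
        by (intro tendsto_intros lim)
      have "l2_inner \<Omega> (T (s n)) g \<le> K * (l2_norm \<Omega> g + l2_norm \<Omega> (\<lambda>x. T (s n) x - g x))" for n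
      proof -
        have "l2_inner \<Omega> (T (s n)) g \<le> \<bar>l (s n)\<bar>"
          using repr[OF s] by (simp add: l2_inner_commute)
        also have "\<dots> \<le> K * l2_norm \<Omega> (T (s n))" by (rule bound[OF s])
        also have "\<dots> \<le> K * (l2_norm \<Omega> g + l2_norm \<Omega> (\<lambda>x. T (s n) x - g x))"
          by (intro mult_left_mono l2_norm_triangle T s g \<open>0 \<le> K\<close>)
        finally show ?thesis .
      qed
      then show "\<exists>N. \<forall>n\<ge>N. l2_inner \<Omega> (T (s n)) g \<le> K * (l2_norm \<Omega> g + l2_norm \<Omega> (\<lambda>x. T (s n) x - g x))"
        by blast
    qed
    then have "l2_norm \<Omega> g * l2_norm \<Omega> g \<le> K * l2_norm \<Omega> g" by (simp add: power2_eq_square)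
    then show ?thesis
      using \<open>0 \<le> K\<close> by (cases "l2_norm \<Omega> g = 0") (auto simp: mult_le_cancel_right)
  qed
  with g repr that show ?thesis by blast
qed

section \<open>Smooth functions\<close>

definition smooth :: "('a::euclidean_space \<Rightarrow> 'b::real_normed_vector) \<Rightarrow> bool" where
  "smooth f \<longleftrightarrow> (\<forall>k. C_k k f)"

lemma C_k_SucI:
  assumes "\<And>x. (f has_derivative f' x) (at x)" and "\<And>h. C_k k (\<lambda>x. f' x h)"
  shows "C_k (Suc k) f"
proof -
  have "frechet_derivative f (at x) = f' x" for x
    using frechet_derivative_at[OF assms(1)] by simp
  then show ?thesis
    using assms by (auto simp: differentiable_def)
qed

lemma smooth_differentiable: "smooth f \<Longrightarrow> f differentiable (at x)"
  unfolding smooth_def by (meson C_k.simps(2))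

lemma smooth_has_derivative:
  "smooth f \<Longrightarrow> (f has_derivative frechet_derivative f (at x)) (at x)"
  using smooth_differentiable frechet_derivative_works by blast

lemma smooth_derivative: "smooth f \<Longrightarrow> smooth (\<lambda>x. frechet_derivative f (at x) h)"
  unfolding smooth_def using C_k.simps(2) by blast

lemma smooth_continuous: "smooth f \<Longrightarrow> continuous_on S f"
  unfolding smooth_def by (metis C_k.simps(1) continuous_on_subset subset_UNIV)

text \<open>
  Smoothness is the largest property that implies differentiability and passes to all directional
  derivatives. This avoids an induction on the order of differentiability whenever a class of functions contains its derivatives.
\<close>

lemma smooth_coinduct:
  assumes "P f"
    and step: "\<And>f. P f \<Longrightarrow> \<exists>f'. (\<forall>x. (f has_derivative f' x) (at x)) \<and> (\<forall>h. P (\<lambda>x. f' x h))"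
  shows "smooth f"
proof -
  have "C_k k f" for k
    using \<open>P f\<close>
  proof (induction k arbitrary: f)
    case 0
    from step[OF this] show ?case
      by (auto simp: continuous_on_eq_continuous_within intro: has_derivative_continuous)
  next
    case (Suc k)
    from step[OF Suc.prems] obtain f' where
      f': "\<And>x. (f has_derivative f' x) (at x)" "\<And>h. P (\<lambda>x. f' x h)" by blast
    show ?case by (rule C_k_SucI[OF f'(1) Suc.IH[OF f'(2)]])
  qed
  then show ?thesis by (simp add: smooth_def)
qed

lemma smooth_const: "smooth (\<lambda>x. c)"
  by (rule smooth_coinduct[where P="\<lambda>f. \<exists>c. f = (\<lambda>x. c)"]) (auto intro!: derivative_eq_intros)

lemma smooth_bounded_linear:
  assumes "bounded_linear L" shows "smooth L"
proof (rule smooth_coinduct[where P="\<lambda>f. f = L \<or> (\<exists>c. f = (\<lambda>x. c))"])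
  fix f assume "f = L \<or> (\<exists>c. f = (\<lambda>x. c))"
  then show "\<exists>f'. (\<forall>x. (f has_derivative f' x) (at x))
      \<and> (\<forall>h. (\<lambda>x. f' x h) = L \<or> (\<exists>c. (\<lambda>x. f' x h) = (\<lambda>x. c)))"
    by (metis assms bounded_linear_imp_has_derivative has_derivative_const)
qed simp

lemma C_k_add: "C_k k f \<Longrightarrow> C_k k g \<Longrightarrow> C_k k (\<lambda>x. f x + g x)"
proof (induction k arbitrary: f g)
  case (Suc k)
  show ?case
  proof (rule C_k_SucI)
    show "((\<lambda>x. f x + g x) has_derivative
        (\<lambda>h. frechet_derivative f (at x) h + frechet_derivative g (at x) h)) (at x)" for x
      using Suc.prems by (intro has_derivative_add) (auto simp: frechet_derivative_works[symmetric])
  qed (use Suc in auto)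
qed (auto intro: continuous_intros)

lemma smooth_add: "smooth f \<Longrightarrow> smooth g \<Longrightarrow> smooth (\<lambda>x. f x + g x)"
  by (simp add: smooth_def C_k_add)

lemma smooth_bilinear:
  assumes B: "bounded_bilinear B" and "smooth f" "smooth g"
  shows "smooth (\<lambda>x. B (f x) (g x))"
proof -
  have "C_k k (\<lambda>x. B (f x) (g x))" for k
    using assms(2,3)
  proof (induction k arbitrary: f g)
    case 0
    have "continuous_on UNIV f" "continuous_on UNIV g"
      using 0 by (auto intro: smooth_continuous)
    from bounded_bilinear.continuous_on[OF B this] show ?case by simp
  next
    case (Suc k)
    show ?case
    proof (rule C_k_SucI)
      show "((\<lambda>x. B (f x) (g x)) has_derivative
          (\<lambda>h. B (f x) (frechet_derivative g (at x) h) + B (frechet_derivative f (at x) h) (g x))) (at x)" for x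
        by (intro bounded_bilinear.FDERIV[OF B] smooth_has_derivative Suc.prems)
      fix h
      have f': "smooth (\<lambda>x. frechet_derivative f (at x) h)" and g': "smooth (\<lambda>x. frechet_derivative g (at x) h)"
        using Suc.prems by (auto intro: smooth_derivative)
      from C_k_add[OF Suc.IH[OF Suc.prems(1) g'] Suc.IH[OF f' Suc.prems(2)]]
      show "C_k k (\<lambda>x. B (f x) (frechet_derivative g (at x) h) + B (frechet_derivative f (at x) h) (g x))" .
    qed
  qed
  then show ?thesis by (simp add: smooth_def)
qed

lemmas smooth_mult = smooth_bilinear[OF bounded_bilinear_mult]
lemmas smooth_inner = smooth_bilinear[OF bounded_bilinear_inner]

lemma smooth_linear_compose:
  assumes L: "bounded_linear L" and "smooth f"
  shows "smooth (\<lambda>x. L (f x))"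
proof (rule smooth_coinduct[where P="\<lambda>u. \<exists>f. smooth f \<and> u = (\<lambda>x. L (f x))"])
  fix u assume "\<exists>f. smooth f \<and> u = (\<lambda>x. L (f x))"
  then obtain f where f: "smooth f" "u = (\<lambda>x. L (f x))" by blast
  show "\<exists>u'. (\<forall>x. (u has_derivative u' x) (at x)) \<and> (\<forall>h. \<exists>f. smooth f \<and> (\<lambda>x. u' x h) = (\<lambda>x. L (f x)))"
    using f bounded_linear.has_derivative[OF L smooth_has_derivative[OF f(1)]] smooth_derivative[OF f(1)]
    by (intro exI[of _ "\<lambda>x h. L (frechet_derivative f (at x) h)"]) blast
qed (use assms in blast)

lemma smooth_minus: "smooth f \<Longrightarrow> smooth (\<lambda>x. - f x)"
  by (rule smooth_linear_compose) (rule bounded_linear_minus[OF bounded_linear_ident])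

lemma smooth_diff: "smooth f \<Longrightarrow> smooth g \<Longrightarrow> smooth (\<lambda>x. f x - g x)"
  using smooth_add[OF _ smooth_minus] by auto

lemma smooth_prod:
  fixes f :: "'i \<Rightarrow> 'a::euclidean_space \<Rightarrow> real"
  assumes "\<And>i. i \<in> I \<Longrightarrow> smooth (f i)"
  shows "smooth (\<lambda>x. \<Prod>i\<in>I. f i x)"
  using assms by (induction I rule: infinite_finite_induct) (auto intro: smooth_const smooth_mult)

text \<open>
  The induction needs an extra smooth factor \<open>u\<close>, because the chain rule produces the product of
  \<open>h' \<circ> g\<close> with a derivative of \<open>g\<close>.
\<close>

lemma smooth_compose_real:
  fixes h :: "real \<Rightarrow> real" and g :: "'a::euclidean_space \<Rightarrow> real"
  assumes "smooth h" and g: "smooth g"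
  shows "smooth (\<lambda>x. h (g x))"
proof -
  have "C_k k (\<lambda>x. h (g x) * u x)" if "smooth u" for k and u :: "'a \<Rightarrow> real"
    using assms(1) that
  proof (induction k arbitrary: h u)
    case 0
    have "continuous_on UNIV (\<lambda>x. h (g x))"
      by (rule continuous_on_compose2[OF smooth_continuous[OF 0(1), of UNIV] smooth_continuous[OF g]]) simp
    from continuous_on_mult[OF this smooth_continuous[OF 0(2)]] show ?case by simp
  next
    case (Suc k)
    let ?h' = "\<lambda>t. frechet_derivative h (at t) 1"
    show ?case
    proof (rule C_k_SucI)
      show "((\<lambda>x. h (g x) * u x) has_derivative
          (\<lambda>d. h (g x) * frechet_derivative u (at x) d + ?h' (g x) * (frechet_derivative g (at x) d * u x))) (at x)"
        for x
      proof -
        have "frechet_derivative h (at (g x)) c = ?h' (g x) * c" for c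
          using linear_scale[OF linear_frechet_derivative[OF smooth_differentiable[OF Suc.prems(1), of "g x"]], of c 1]
          by simp
        then have eq: "(\<lambda>d. frechet_derivative h (at (g x)) (frechet_derivative g (at x) d))
            = (\<lambda>d. ?h' (g x) * frechet_derivative g (at x) d)"
          by (rule ext)
        have "((\<lambda>x. h (g x)) has_derivative (\<lambda>d. ?h' (g x) * frechet_derivative g (at x) d)) (at x)"
          unfolding eq[symmetric]
          by (rule has_derivative_compose[OF smooth_has_derivative[OF g] smooth_has_derivative[OF Suc.prems(1)]])
        from has_derivative_mult[OF this smooth_has_derivative[OF Suc.prems(2)]]
        show ?thesis by (simp add: mult.assoc)
      qed
      fix d
      have "smooth (\<lambda>x. frechet_derivative u (at x) d)"
        by (rule smooth_derivative[OF Suc.prems(2)])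
      from Suc.IH[OF Suc.prems(1) this]
      have 1: "C_k k (\<lambda>x. h (g x) * frechet_derivative u (at x) d)" .
      have "smooth (\<lambda>x. frechet_derivative g (at x) d * u x)"
        by (rule smooth_mult[OF smooth_derivative[OF g] Suc.prems(2)])
      from Suc.IH[OF smooth_derivative[OF Suc.prems(1)] this]
      have 2: "C_k k (\<lambda>x. ?h' (g x) * (frechet_derivative g (at x) d * u x))" .
      from C_k_add[OF 1 2] show "C_k k (\<lambda>x. h (g x) * frechet_derivative u (at x) d
          + ?h' (g x) * (frechet_derivative g (at x) d * u x))" .
    qed
  qed
  from this[OF smooth_const[of 1]] show ?thesis by (simp add: smooth_def)
qed

text \<open>
  The factor \<open>p\<close>, a polynomial in \<open>1/t\<close>, makes the class of these functions closed under
  differentiation; \<open>p = 1\<close> gives the classical function \<open>exp (-1/t)\<close>.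
\<close>

definition flat_exp :: "real poly \<Rightarrow> real \<Rightarrow> real" where
  "flat_exp p t = (if 0 < t then poly p (inverse t) * exp (- inverse t) else 0)"

lemma poly_exp_tendsto_0: "((\<lambda>s. poly p s * exp (- s)) \<longlongrightarrow> (0::real)) at_top"
proof (induction p)
  case 0
  then show ?case by simp
next
  case (pCons a p)
  have "((\<lambda>s. \<Sum>i\<le>degree (pCons a p). coeff (pCons a p) i * (s ^ i / exp s)) \<longlongrightarrow> 0) at_top"
    by (intro tendsto_null_sum tendsto_mult_right_zero tendsto_power_div_exp_0)
  then show ?case
    by (simp add: poly_altdef sum_distrib_right exp_minus divide_inverse mult.assoc)
qed

lemma flat_exp_tendsto_0: "(flat_exp p \<longlongrightarrow> 0) (at 0)"
proof -
  have "(flat_exp p \<longlongrightarrow> 0) (at_right 0)"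
  proof (rule Lim_transform_eventually)
    show "((\<lambda>t. poly p (inverse t) * exp (- inverse t)) \<longlongrightarrow> 0) (at_right 0)"
      by (rule filterlim_compose[OF poly_exp_tendsto_0 filterlim_inverse_at_top_right])
    show "\<forall>\<^sub>F t in at_right 0. poly p (inverse t) * exp (- inverse t) = flat_exp p t"
      by (auto simp: flat_exp_def eventually_at_filter)
  qed
  moreover have "(flat_exp p \<longlongrightarrow> 0) (at_left 0)"
    by (rule Lim_transform_eventually[OF tendsto_const])
      (auto simp: flat_exp_def eventually_at_filter)
  ultimately show ?thesis by (simp add: filterlim_split_at)
qed

lemma flat_exp_has_derivative:
  "(flat_exp p has_field_derivative flat_exp ([:0, 0, 1:] * (p - pderiv p)) t) (at t)"
proof -
  consider "t > 0" | "t < 0" | "t = 0" by linarith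
  then show ?thesis
  proof cases
    case 1
    have "((\<lambda>t. poly p (inverse t) * exp (- inverse t)) has_field_derivative
        flat_exp ([:0, 0, 1:] * (p - pderiv p)) t) (at t)"
      using 1 by (auto intro!: derivative_eq_intros simp: flat_exp_def power2_eq_square algebra_simps)
    then show ?thesis
      by (rule has_field_derivative_transform_within_open[where S="{0<..}"])
        (use 1 in \<open>auto simp: flat_exp_def\<close>)
  next
    case 2
    have "((\<lambda>t. 0) has_field_derivative flat_exp ([:0, 0, 1:] * (p - pderiv p)) t) (at t)"
      using 2 by (auto simp: flat_exp_def)
    then show ?thesis
      by (rule has_field_derivative_transform_within_open[where S="{..<0}"])
        (use 2 in \<open>auto simp: flat_exp_def\<close>)
  next
    case 3
    have "((\<lambda>t. (flat_exp p t - flat_exp p 0) / (t - 0)) \<longlongrightarrow> 0) (at 0)"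
      by (rule Lim_transform_eventually[OF flat_exp_tendsto_0[of "[:0, 1:] * p"]])
        (auto simp: flat_exp_def eventually_at_filter divide_inverse)
    then show ?thesis
      using 3 by (simp add: has_field_derivative_iff flat_exp_def)
  qed
qed

lemma smooth_flat_exp: "smooth (flat_exp p)"
proof (rule smooth_coinduct[where P="\<lambda>f. \<exists>p. f = flat_exp p"])
  fix f assume "\<exists>p. f = flat_exp p"
  then obtain p where p: "f = flat_exp p" by blast
  let ?q = "[:0, 0, 1:] * (p - pderiv p)"
  have "(f has_derivative (\<lambda>h. flat_exp ([:h:] * ?q) x)) (at x)" for x
  proof -
    have "(\<lambda>h. flat_exp ([:h:] * ?q) x) = (*) (flat_exp ?q x)"
      by (auto simp: flat_exp_def)
    then show ?thesis
      using flat_exp_has_derivative[of p x] p by (simp add: has_field_derivative_def)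
  qed
  then show "\<exists>f'. (\<forall>x. (f has_derivative f' x) (at x)) \<and> (\<forall>h. \<exists>p. (\<lambda>x. f' x h) = flat_exp p)"
    by (intro exI[of _ "\<lambda>x h. flat_exp ([:h:] * ?q) x"]) blast
qed blast

section \<open>Test functions and integration by parts\<close>

lemma test_functionsI:
  assumes "smooth \<phi>" "compact K" "K \<subseteq> \<Omega>" "\<And>x. x \<notin> K \<Longrightarrow> \<phi> x = 0"
  shows "\<phi> \<in> test_functions \<Omega>"
proof -
  have "closure {x. \<phi> x \<noteq> 0} \<subseteq> K"
    using assms(2,4) by (intro closure_minimal) (auto dest: compact_imp_closed)
  moreover from this have "compact (closure {x. \<phi> x \<noteq> 0})"
    using assms(2) bounded_subset[of K] by (auto simp: compact_eq_bounded_closed)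
  ultimately show ?thesis
    using assms by (auto simp: test_functions_def smooth_def)
qed

lemma test_function_smooth: "\<phi> \<in> test_functions \<Omega> \<Longrightarrow> smooth \<phi>"
  by (simp add: test_functions_def smooth_def)

lemma test_function_support:
  assumes "\<phi> \<in> test_functions \<Omega>"
  obtains K where "compact K" "K \<subseteq> \<Omega>" "\<And>x. x \<notin> K \<Longrightarrow> \<phi> x = 0"
proof (rule that)
  show "x \<notin> closure {x. \<phi> x \<noteq> 0} \<Longrightarrow> \<phi> x = 0" for x
    using closure_subset[of "{x. \<phi> x \<noteq> 0}"] by auto
qed (use assms in \<open>auto simp: test_functions_def\<close>)

lemma test_function_outside: "\<phi> \<in> test_functions \<Omega> \<Longrightarrow> x \<notin> \<Omega> \<Longrightarrow> \<phi> x = 0"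
  by (rule test_function_support[of \<phi> \<Omega>]) auto

lemma test_function_derivative:
  assumes "\<phi> \<in> test_functions \<Omega>"
  shows "(\<lambda>x. frechet_derivative \<phi> (at x) h) \<in> test_functions \<Omega>"
proof -
  obtain K where K: "compact K" "K \<subseteq> \<Omega>" "\<And>x. x \<notin> K \<Longrightarrow> \<phi> x = 0"
    using test_function_support[OF assms] by blast
  show ?thesis
  proof (rule test_functionsI[OF smooth_derivative[OF test_function_smooth[OF assms]] K(1,2)])
    fix x assume "x \<notin> K"
    then have "(\<phi> has_derivative (\<lambda>h. 0)) (at x)"
      using K by (intro has_derivative_transform_within_open[OF has_derivative_const, of "- K"])
        (auto simp: compact_imp_closed)
    from frechet_derivative_at[OF this] show "frechet_derivative \<phi> (at x) h = 0"
      by (simp add: fun_eq_iff)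
  qed
qed

lemma test_function_bilinear:
  assumes B: "bounded_bilinear B" and "smooth f" "\<phi> \<in> test_functions \<Omega>"
  shows "(\<lambda>x. B (f x) (\<phi> x)) \<in> test_functions \<Omega>"
proof -
  obtain K where K: "compact K" "K \<subseteq> \<Omega>" "\<And>x. x \<notin> K \<Longrightarrow> \<phi> x = 0"
    using test_function_support[OF assms(3)] by blast
  show ?thesis
    by (rule test_functionsI[OF smooth_bilinear[OF B assms(2) test_function_smooth[OF assms(3)]] K(1,2)])
      (simp add: K(3) bounded_bilinear.zero_right[OF B])
qed

lemmas test_function_mult = test_function_bilinear[OF bounded_bilinear_mult]

lemma test_function_linear:
  assumes L: "bounded_linear L" and "\<phi> \<in> test_functions \<Omega>"
  shows "(\<lambda>x. L (\<phi> x)) \<in> test_functions \<Omega>"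
proof -
  obtain K where K: "compact K" "K \<subseteq> \<Omega>" "\<And>x. x \<notin> K \<Longrightarrow> \<phi> x = 0"
    using test_function_support[OF assms(2)] by blast
  show ?thesis
    by (rule test_functionsI[OF smooth_linear_compose[OF L test_function_smooth[OF assms(2)]] K(1,2)])
      (simp add: K(3) linear_0 bounded_linear.linear[OF L])
qed

lemma test_function_add:
  assumes "\<phi> \<in> test_functions \<Omega>" "\<psi> \<in> test_functions \<Omega>"
  shows "(\<lambda>x. \<phi> x + \<psi> x) \<in> test_functions \<Omega>"
proof -
  obtain K where K: "compact K" "K \<subseteq> \<Omega>" "\<And>x. x \<notin> K \<Longrightarrow> \<phi> x = 0"
    using test_function_support[OF assms(1)] by blast
  obtain K' where K': "compact K'" "K' \<subseteq> \<Omega>" "\<And>x. x \<notin> K' \<Longrightarrow> \<psi> x = 0"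
    using test_function_support[OF assms(2)] by blast
  show ?thesis
  proof (rule test_functionsI[of _ "K \<union> K'"])
    show "smooth (\<lambda>x. \<phi> x + \<psi> x)"
      using assms by (intro smooth_add) (auto dest: test_function_smooth)
  qed (use K K' in \<open>auto intro: compact_Un\<close>)
qed

lemma test_function_zero: "(\<lambda>x. 0) \<in> test_functions \<Omega>"
  by (rule test_functionsI[OF smooth_const compact_empty]) auto

lemma test_function_sum:
  assumes "\<And>i. i \<in> I \<Longrightarrow> f i \<in> test_functions \<Omega>"
  shows "(\<lambda>x. \<Sum>i\<in>I. f i x) \<in> test_functions \<Omega>"
  using assms
  by (induction I rule: infinite_finite_induct) (auto intro: test_function_add test_function_zero)

lemma test_function_bounded:
  assumes "\<phi> \<in> test_functions \<Omega>"
  obtains b where "0 < b" "\<And>x. norm (\<phi> x) \<le> b"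
proof -
  obtain K where K: "compact K" "K \<subseteq> \<Omega>" "\<And>x. x \<notin> K \<Longrightarrow> \<phi> x = 0"
    using test_function_support[OF assms] by blast
  have "bounded (\<phi> ` K)"
    by (intro compact_imp_bounded compact_continuous_image smooth_continuous
        test_function_smooth[OF assms] K)
  then obtain b where "0 < b" "\<And>x. x \<in> K \<Longrightarrow> norm (\<phi> x) \<le> b"
    by (auto simp: bounded_pos)
  then have "norm (\<phi> x) \<le> b" for x
    using K(3)[of x] by (cases "x \<in> K") auto
  with \<open>0 < b\<close> show ?thesis by (rule that)
qed

lemma test_function_borel [measurable_dest]:
  "\<phi> \<in> test_functions \<Omega> \<Longrightarrow> \<phi> \<in> borel_measurable borel"
  by (intro borel_measurable_continuous_onI smooth_continuous test_function_smooth)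

lemma smooth_lebesgue_measurable:
  fixes f :: "'a::euclidean_space \<Rightarrow> 'b::euclidean_space"
  assumes "smooth f" shows "f \<in> borel_measurable (lebesgue_on \<Omega>)"
  using borel_measurable_continuous_onI[OF smooth_continuous[OF assms]]
  by (intro measurable_restrict_space1 measurable_completion) simp

lemma test_function_L2:
  fixes \<phi> :: "'a::euclidean_space \<Rightarrow> 'b::euclidean_space"
  assumes "\<Omega> \<in> lmeasurable" "\<phi> \<in> test_functions \<Omega>"
  shows "\<phi> \<in> L2 \<Omega> UNIV"
proof -
  obtain b where b: "\<And>x. norm (\<phi> x) \<le> b"
    using test_function_bounded[OF assms(2)] by blast
  show ?thesis
  proof (rule L2_dominated[OF L2_const[OF assms(1), of "1::real"]])
    show "AE x in lebesgue_on \<Omega>. norm (\<phi> x) \<le> b * norm (1::real)"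
      using b by simp
  qed (rule smooth_lebesgue_measurable[OF test_function_smooth[OF assms(2)]])
qed

lemma test_function_integrable:
  fixes \<phi> :: "'a::euclidean_space \<Rightarrow> 'b::euclidean_space"
  assumes \<phi>: "\<phi> \<in> test_functions \<Omega>"
  shows "integrable lborel \<phi>"
proof -
  obtain b where b: "\<And>x. norm (\<phi> x) \<le> b"
    using test_function_bounded[OF \<phi>] by blast
  obtain K where K: "compact K" "K \<subseteq> \<Omega>" "\<And>x. x \<notin> K \<Longrightarrow> \<phi> x = 0"
    using test_function_support[OF \<phi>] by blast
  show ?thesis
  proof (rule Bochner_Integration.integrable_bound[of _ "\<lambda>x. b * indicator K x"])
    show "integrable lborel (\<lambda>x. b * indicator K x)"
      using emeasure_compact_finite[OF K(1)] K(1)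
      by (intro integrable_mult_right integrable_real_indicator) (auto intro: borel_compact)
    show "AE x in lborel. norm (\<phi> x) \<le> norm (b * indicator K x)"
      using b K(3) by (auto simp: indicator_def intro: order_trans[OF _ abs_ge_self])
  qed (use test_function_borel[OF \<phi>] in simp)
qed

lemma integral_test_function:
  fixes \<phi> :: "'a::euclidean_space \<Rightarrow> 'b::euclidean_space"
  assumes "\<Omega> \<in> sets lebesgue" "\<phi> \<in> test_functions \<Omega>"
  shows "(LINT x|lebesgue_on \<Omega>. \<phi> x) = (LINT x|lborel. \<phi> x)"
proof -
  have "(LINT x|lebesgue_on \<Omega>. \<phi> x) = (LINT x|lebesgue. indicator \<Omega> x *\<^sub>R \<phi> x)"
    using assms(1) by (simp add: integral_restrict_space)
  also have "\<dots> = (LINT x|lebesgue. \<phi> x)"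
    by (rule Bochner_Integration.integral_cong)
      (auto simp: indicator_def test_function_outside[OF assms(2)])
  also have "\<dots> = (LINT x|lborel. \<phi> x)"
    using test_function_borel[OF assms(2)] by (simp add: integral_completion)
  finally show ?thesis .
qed

text \<open>
  Translation invariance is the source of integration by parts: a difference quotient of an integrable
  function has integral zero.
\<close>

lemma lborel_integral_translate:
  fixes f :: "'a::euclidean_space \<Rightarrow> 'b::euclidean_space"
  assumes [measurable]: "f \<in> borel_measurable borel"
  shows "(LINT x|lborel. f (x + c)) = (LINT x|lborel. f x)"
    and "integrable lborel (\<lambda>x. f (x + c)) \<longleftrightarrow> integrable lborel f"
proof -
  have "(LINT x|lborel. f x) = (LINT x|distr lborel borel ((+) c). f x)"
    by (simp add: lborel_distr_plus)
  also have "\<dots> = (LINT x|lborel. f (x + c))"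
    by (subst integral_distr) (auto simp: add.commute)
  finally show "(LINT x|lborel. f (x + c)) = (LINT x|lborel. f x)" by simp
  have "integrable lborel f \<longleftrightarrow> integrable (distr lborel borel ((+) c)) f"
    by (simp add: lborel_distr_plus)
  also have "\<dots> \<longleftrightarrow> integrable lborel (\<lambda>x. f (x + c))"
    by (subst integrable_distr_eq) (auto simp: add.commute)
  finally show "integrable lborel (\<lambda>x. f (x + c)) \<longleftrightarrow> integrable lborel f" by simp
qed

text \<open>
  The difference quotients of \<open>\<phi>\<close> in direction \<open>e\<close> have integral zero by translation invariance. By the
  mean value theorem they are dominated by \<open>sup \<bar>\<partial>\<^sub>e \<phi>\<bar>\<close> times the indicator of a large ball, so their
  limit \<open>\<partial>\<^sub>e \<phi>\<close> has integral zero as well.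
\<close>

lemma integral_derivative_test_function:
  fixes \<phi> :: "'a::euclidean_space \<Rightarrow> real"
  assumes \<Omega>: "\<Omega> \<in> sets lebesgue" and \<phi>: "\<phi> \<in> test_functions \<Omega>"
  shows "(LINT x|lebesgue_on \<Omega>. frechet_derivative \<phi> (at x) e) = 0"
proof -
  let ?D = "\<lambda>x. frechet_derivative \<phi> (at x) e"
  have D: "?D \<in> test_functions \<Omega>" by (rule test_function_derivative[OF \<phi>])
  obtain b where b: "0 < b" "\<And>x. norm (?D x) \<le> b"
    using test_function_bounded[OF D] by blast
  obtain K where K: "compact K" "K \<subseteq> \<Omega>" "\<And>x. x \<notin> K \<Longrightarrow> \<phi> x = 0"
    using test_function_support[OF \<phi>] by blast
  obtain R where R: "\<And>x. x \<in> K \<Longrightarrow> norm x \<le> R"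
    using compact_imp_bounded[OF K(1)] by (auto simp: bounded_iff)
  have line: "((\<lambda>t. \<phi> (x + t *\<^sub>R e)) has_real_derivative ?D (x + t *\<^sub>R e)) (at t)" for x t
  proof -
    have "((\<lambda>t. x + t *\<^sub>R e) has_derivative (\<lambda>s. s *\<^sub>R e)) (at t)"
      by (auto intro!: derivative_eq_intros)
    from has_derivative_compose[OF this smooth_has_derivative[OF test_function_smooth[OF \<phi>]]]
    have "((\<lambda>t. \<phi> (x + t *\<^sub>R e)) has_derivative
        (\<lambda>s. frechet_derivative \<phi> (at (x + t *\<^sub>R e)) (s *\<^sub>R e))) (at t)" .
    moreover have "frechet_derivative \<phi> (at y) (s *\<^sub>R e) = ?D y * s" for y s
      using linear_scale[OF linear_frechet_derivative[OF smooth_differentiable[OF test_function_smooth[OF \<phi>]]]]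
      by simp
    ultimately show ?thesis by (simp add: has_field_derivative_def)
  qed
  let ?t = "\<lambda>n::nat. inverse (real (Suc n))"
  let ?q = "\<lambda>n x. (\<phi> (x + ?t n *\<^sub>R e) - \<phi> x) / ?t n"
  note [measurable] = test_function_borel[OF \<phi>] test_function_borel[OF D]
  have "(LINT x|lborel. ?q n x) = 0" for n
    using lborel_integral_translate[of \<phi> "?t n *\<^sub>R e"] test_function_integrable[OF \<phi>]
    by simp
  moreover have "(\<lambda>n. LINT x|lborel. ?q n x) \<longlonglongrightarrow> (LINT x|lborel. ?D x)"
  proof (rule integral_dominated_convergence)
    show "integrable lborel (\<lambda>x. b * indicator (cball 0 (R + norm e)) x)"
      using emeasure_compact_finite[OF compact_cball]
      by (intro integrable_mult_right integrable_real_indicator) auto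
    show "AE x in lborel. (\<lambda>n. ?q n x) \<longlonglongrightarrow> ?D x"
    proof (rule AE_I2)
      fix x
      have "((\<lambda>h. (\<phi> (x + h *\<^sub>R e) - \<phi> x) / h) \<longlongrightarrow> ?D x) (at 0)"
        using line[of x 0] by (simp add: DERIV_def)
      moreover have "filterlim ?t (at 0) sequentially"
        using LIMSEQ_inverse_real_of_nat by (auto simp: filterlim_at)
      ultimately show "(\<lambda>n. ?q n x) \<longlonglongrightarrow> ?D x"
        by (rule filterlim_compose)
    qed
    show "AE x in lborel. norm (?q n x) \<le> b * indicator (cball 0 (R + norm e)) x" for n
    proof (rule AE_I2)
      fix x
      have t: "0 < ?t n" "?t n \<le> 1" by (auto simp: field_simps)
      show "norm (?q n x) \<le> b * indicator (cball 0 (R + norm e)) x"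
      proof (cases "x \<in> cball 0 (R + norm e)")
        case True
        obtain z where "\<phi> (x + ?t n *\<^sub>R e) - \<phi> (x + 0 *\<^sub>R e) = (?t n - 0) * ?D (x + z *\<^sub>R e)"
          using MVT2[OF t(1), of "\<lambda>t. \<phi> (x + t *\<^sub>R e)" "\<lambda>t. ?D (x + t *\<^sub>R e)"] line by blast
        then have "?q n x = ?D (x + z *\<^sub>R e)" using t by simp
        then show ?thesis using b True by simp
      next
        case False
        then have far: "R + norm e < norm x" by simp
        then have "x \<notin> K" using R[of x] norm_ge_zero[of e] by linarith
        moreover have "x + ?t n *\<^sub>R e \<notin> K"
        proof
          assume "x + ?t n *\<^sub>R e \<in> K"
          then have "norm (x + ?t n *\<^sub>R e) \<le> R" by (rule R)
          moreover have "norm (?t n *\<^sub>R e) \<le> norm e"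
            using t by (simp add: mult_left_le_one_le)
          moreover have "norm x \<le> norm (x + ?t n *\<^sub>R e) + norm (?t n *\<^sub>R e)"
            by (metis add_diff_cancel_right' norm_triangle_ineq4)
          ultimately show False using far by linarith
        qed
        ultimately show ?thesis using False by (simp add: K(3))
      qed
    qed
  qed simp_all
  ultimately have "(\<lambda>n::nat. 0) \<longlonglongrightarrow> (LINT x|lborel. ?D x)"
    by (simp only:)
  from LIMSEQ_unique[OF this tendsto_const] have "(LINT x|lborel. ?D x) = 0" .
  then show ?thesis
    using integral_test_function[OF \<Omega> D] by simp
qed

section \<open>The fundamental lemma and a directional Poincare inequality\<close>

text \<open>
  With \<open>s = r\<^sup>2 - \<bar>x - c\<bar>\<^sup>2\<close> this is \<open>exp (-1/((n+1) s))\<close> on the ball and zero outside: smooth for every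
  \<open>n\<close>, and increasing in \<open>n\<close> to the indicator of the ball.
\<close>

definition ball_bump :: "nat \<Rightarrow> 'a::euclidean_space \<Rightarrow> real \<Rightarrow> 'a \<Rightarrow> real" where
  "ball_bump n c r x = flat_exp 1 (real (Suc n) * (r\<^sup>2 - (x - c) \<bullet> (x - c)))"

lemma smooth_ball_bump: "smooth (ball_bump n c r)"
proof -
  have "smooth (\<lambda>x. x - c)"
    by (rule smooth_diff[OF smooth_bounded_linear[OF bounded_linear_ident] smooth_const])
  then have "smooth (\<lambda>x. (x - c) \<bullet> (x - c))"
    by (rule smooth_inner) fact
  then have "smooth (\<lambda>x. real (Suc n) * (r\<^sup>2 - (x - c) \<bullet> (x - c)))"
    by (rule smooth_mult[OF smooth_const smooth_diff[OF smooth_const]])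
  from smooth_compose_real[OF smooth_flat_exp this] show ?thesis
    unfolding ball_bump_def .
qed

lemma inner_less_power2_iff:
  assumes "0 < r" shows "(x - c) \<bullet> (x - c) < r\<^sup>2 \<longleftrightarrow> x \<in> ball c r"
proof -
  have "x \<in> ball c r \<longleftrightarrow> norm (x - c) < r"
    by (simp add: dist_norm norm_minus_commute)
  also have "\<dots> \<longleftrightarrow> (x - c) \<bullet> (x - c) < r\<^sup>2"
    using assms norm_lt_square[of "x - c" r] by blast
  finally show ?thesis by blast
qed

lemma ball_bump_bounds: "0 \<le> ball_bump n c r x" "ball_bump n c r x \<le> 1"
  by (simp_all add: ball_bump_def flat_exp_def zero_less_mult_iff)

lemma ball_bump_outside:
  assumes "0 < r" "x \<notin> ball c r" shows "ball_bump n c r x = 0"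
  using assms inner_less_power2_iff[of r x c]
  by (simp add: ball_bump_def flat_exp_def zero_less_mult_iff not_less)

lemma ball_bump_tendsto_1:
  assumes "0 < r" "x \<in> ball c r" shows "(\<lambda>n. ball_bump n c r x) \<longlonglongrightarrow> 1"
proof -
  let ?s = "r\<^sup>2 - (x - c) \<bullet> (x - c)"
  have s: "0 < ?s" using assms inner_less_power2_iff[of r x c] by simp
  have "(\<lambda>n. exp (- (inverse (real (Suc n)) * inverse ?s))) \<longlonglongrightarrow> exp (- (0 * inverse ?s))"
    by (intro tendsto_intros LIMSEQ_inverse_real_of_nat)
  moreover have "ball_bump n c r x = exp (- (inverse (real (Suc n)) * inverse ?s))" for n
    using s by (simp add: ball_bump_def flat_exp_def zero_less_mult_iff del: of_nat_Suc)
  ultimately show ?thesis by simp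
qed

text \<open>
  Cover \<open>U\<close> by countably many balls whose closures lie in \<open>U\<close>, and take the complementary products
  \<open>1 - \<Prod>\<^sub>i\<^sub><\<^sub>n (1 - \<beta>\<^sub>i)\<close> of bumps \<open>\<beta>\<^sub>i\<close>: a smooth substitute for the indicator of a finite union of balls.
\<close>

lemma open_indicator_test_function_limit:
  fixes U :: "'a::euclidean_space set"
  assumes "open U"
  obtains \<phi> :: "nat \<Rightarrow> 'a \<Rightarrow> real" where
    "\<And>n. \<phi> n \<in> test_functions U" "\<And>n x. 0 \<le> \<phi> n x \<and> \<phi> n x \<le> 1"
    "\<And>x. (\<lambda>n. \<phi> n x) \<longlonglongrightarrow> indicator U x"
proof (cases "U = {}")
  case True
  show ?thesis
    by (rule that[of "\<lambda>n x. 0"]) (auto simp: test_function_zero True)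
next
  case False
  define \<F> where "\<F> = {ball c r |c r. 0 < r \<and> cball c r \<subseteq> U}"
  obtain \<F>' where \<F>': "\<F>' \<subseteq> \<F>" "countable \<F>'" "\<Union>\<F>' = \<Union>\<F>"
    using Lindelof[of \<F>] by (auto simp: \<F>_def)
  have "\<Union>\<F> = U"
  proof
    show "\<Union>\<F> \<subseteq> U"
      by (force simp: \<F>_def)
    show "U \<subseteq> \<Union>\<F>"
    proof
      fix x assume "x \<in> U"
      then obtain r where "0 < r" "cball x r \<subseteq> U"
        using \<open>open U\<close> open_contains_cball by blast
      then show "x \<in> \<Union>\<F>"
        by (auto simp: \<F>_def intro!: exI[of _ "ball x r"] exI[of _ x])
    qed
  qed
  then have "\<F>' \<noteq> {}" using False \<F>' by auto
  then have range: "range (from_nat_into \<F>') = \<F>'"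
    using \<F>'(2) by (rule range_from_nat_into)
  have "\<exists>c r. from_nat_into \<F>' n = ball c r \<and> 0 < r \<and> cball c r \<subseteq> U" for n
  proof -
    have "from_nat_into \<F>' n \<in> \<F>" using range \<F>'(1) by blast
    then show ?thesis by (auto simp: \<F>_def)
  qed
  then obtain c r where B: "\<And>n. from_nat_into \<F>' n = ball (c n) (r n)"
    and r: "\<And>n. 0 < r n" and sub: "\<And>n. cball (c n) (r n) \<subseteq> U"
    by metis
  have "range (\<lambda>n. ball (c n) (r n)) = \<F>'"
    using range B by simp
  then have cover: "(\<Union>n. ball (c n) (r n)) = U"
    using \<F>'(3) \<open>\<Union>\<F> = U\<close> by simp
  define \<phi> where "\<phi> n x = 1 - (\<Prod>i<n. 1 - ball_bump n (c i) (r i) x)" for n x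
  have factor: "0 \<le> 1 - ball_bump n (c i) (r i) x" "1 - ball_bump n (c i) (r i) x \<le> 1" for n i x
    using ball_bump_bounds[of n "c i" "r i" x] by auto
  have bounds: "0 \<le> \<phi> n x \<and> \<phi> n x \<le> 1" for n x
    unfolding \<phi>_def using factor by (auto intro!: prod_nonneg prod_le_1)
  have "\<phi> n \<in> test_functions U" for n
  proof (rule test_functionsI)
    show "smooth (\<phi> n)"
      unfolding \<phi>_def by (intro smooth_diff smooth_const smooth_prod smooth_ball_bump)
    show "compact (\<Union>i<n. cball (c i) (r i))" by (intro compact_UN) auto
    show "(\<Union>i<n. cball (c i) (r i)) \<subseteq> U" using sub by blast
    fix x assume "x \<notin> (\<Union>i<n. cball (c i) (r i))"
    then have "ball_bump n (c i) (r i) x = 0" if "i < n" for i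
      using that by (intro ball_bump_outside r) (force simp: less_imp_le)
    then show "\<phi> n x = 0" by (simp add: \<phi>_def)
  qed
  moreover have "(\<lambda>n. \<phi> n x) \<longlonglongrightarrow> indicator U x" for x
  proof (cases "x \<in> U")
    case True
    then obtain i where i: "x \<in> ball (c i) (r i)" using cover by auto
    have "(\<lambda>n. \<phi> n x) \<longlonglongrightarrow> 1"
    proof (rule real_tendsto_sandwich[OF _ _ ball_bump_tendsto_1[OF r i] tendsto_const[of 1]])
      have "ball_bump n (c i) (r i) x \<le> \<phi> n x" if "i < n" for n
      proof -
        have "(\<Prod>j<n. 1 - ball_bump n (c j) (r j) x)
            = (1 - ball_bump n (c i) (r i) x) * (\<Prod>j\<in>{..<n} - {i}. 1 - ball_bump n (c j) (r j) x)"
          using that by (intro prod.remove) auto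
        also have "\<dots> \<le> (1 - ball_bump n (c i) (r i) x) * 1"
          by (intro mult_left_mono prod_le_1) (use factor in auto)
        finally show ?thesis by (simp add: \<phi>_def)
      qed
      then show "\<forall>\<^sub>F n in sequentially. ball_bump n (c i) (r i) x \<le> \<phi> n x"
        by (intro eventually_sequentiallyI[of "Suc i"]) simp
    qed (use bounds in simp)
    then show ?thesis using True by simp
  next
    case False
    then have "ball_bump n (c i) (r i) x = 0" for n i
      using cover r by (intro ball_bump_outside) auto
    then show ?thesis using False by (simp add: \<phi>_def)
  qed
  ultimately show ?thesis using bounds that by blast
qed

lemma test_functions_mono: "U \<subseteq> \<Omega> \<Longrightarrow> test_functions U \<subseteq> test_functions \<Omega>"
  by (auto simp: test_functions_def)

text \<open>
  Approximating indicators by test functions shows that \<open>f\<close> has integral zero over every open subset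
  of \<open>\<Omega>\<close>. Outer regularity extends this to every measurable subset, and a function with this
  property vanishes almost everywhere.
\<close>

lemma fundamental_lemma_real:
  fixes f :: "'a::euclidean_space \<Rightarrow> real"
  assumes "open \<Omega>" and fin: "\<Omega> \<in> lmeasurable" and f: "integrable (lebesgue_on \<Omega>) f"
    and orth: "\<And>\<phi>. \<phi> \<in> test_functions \<Omega> \<Longrightarrow> (LINT x|lebesgue_on \<Omega>. \<phi> x * f x) = 0"
  shows "AE x in lebesgue_on \<Omega>. f x = 0"
proof (rule sigma_finite_measure.density_zero[OF _ f])
  show "sigma_finite_measure (lebesgue_on \<Omega>)"
    using finite_measure_lebesgue_on[OF fin] by (rule finite_measure.axioms(1))
  let ?M = "lebesgue_on \<Omega>"
  have sets: "\<Omega> \<in> sets lebesgue" using \<open>open \<Omega>\<close> by auto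
  have set_M: "A \<in> sets ?M" if "A \<in> sets lebesgue" "A \<subseteq> \<Omega>" for A
    using that sets by (auto simp: sets_restrict_space_iff)
  note [measurable] = borel_measurable_integrable[OF f]
  have open_zero: "set_lebesgue_integral ?M U f = 0" if "open U" "U \<subseteq> \<Omega>" for U
  proof -
    obtain \<phi> :: "nat \<Rightarrow> 'a \<Rightarrow> real" where \<phi>: "\<And>n. \<phi> n \<in> test_functions U"
      "\<And>n x. 0 \<le> \<phi> n x \<and> \<phi> n x \<le> 1" "\<And>x. (\<lambda>n. \<phi> n x) \<longlonglongrightarrow> indicator U x"
      using open_indicator_test_function_limit[OF \<open>open U\<close>] by blast
    have [measurable]: "\<phi> n \<in> borel_measurable ?M" for n
      by (rule smooth_lebesgue_measurable[OF test_function_smooth[OF \<phi>(1)]])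
    have [measurable]: "U \<in> sets ?M"
      using that by (intro set_M) auto
    have "(\<lambda>n. LINT x|?M. \<phi> n x * f x) \<longlonglongrightarrow> (LINT x|?M. indicator U x * f x)"
    proof (rule integral_dominated_convergence)
      show "integrable ?M (\<lambda>x. norm (f x))" using f by (rule integrable_norm)
      show "AE x in ?M. (\<lambda>n. \<phi> n x * f x) \<longlonglongrightarrow> indicator U x * f x"
        by (intro AE_I2 tendsto_mult_right \<phi>(3))
      show "AE x in ?M. norm (\<phi> n x * f x) \<le> norm (f x)" for n
        using \<phi>(2)[of n] by (intro AE_I2) (simp add: abs_mult mult_left_le_one_le)
    qed measurable
    moreover have "(LINT x|?M. \<phi> n x * f x) = 0" for n
      using \<phi>(1) test_functions_mono[OF \<open>U \<subseteq> \<Omega>\<close>] by (intro orth) auto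
    ultimately have "(\<lambda>n::nat. 0) \<longlonglongrightarrow> (LINT x|?M. indicator U x * f x)"
      by simp
    from LIMSEQ_unique[OF this tendsto_const] show ?thesis
      by (simp add: set_lebesgue_integral_def)
  qed
  fix A assume A_M: "A \<in> sets ?M"
  then have A: "A \<in> sets lebesgue" "A \<subseteq> \<Omega>"
    using sets by (auto simp: sets_restrict_space_iff)
  have "\<exists>T. open T \<and> A \<subseteq> T \<and> emeasure lebesgue (T - A) < ennreal (inverse (real (Suc n)))" for n
    using sets_lebesgue_outer_open[OF A(1), of "inverse (real (Suc n))"] by (metis inverse_positive_iff_positive of_nat_0_less_iff zero_less_Suc)
  then obtain T where T: "\<And>n. open (T n)" "\<And>n. A \<subseteq> T n"
    "\<And>n. emeasure lebesgue (T n - A) < ennreal (inverse (real (Suc n)))"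
    by metis
  \<comment> \<open>Open subsets of \<open>\<Omega>\<close> that decrease to \<open>A\<close> up to a null set.\<close>
  define V where "V n = \<Omega> \<inter> (\<Inter>i\<le>n. T i)" for n
  have V_open: "open (V n)" for n
    unfolding V_def using T(1) \<open>open \<Omega>\<close> by (intro open_Int open_INT) auto
  have V_sets: "V n \<in> sets ?M" for n
    using V_open by (intro set_M) (auto simp: V_def)
  have Int_sets: "(\<Inter>n. V n) \<in> sets ?M"
    using V_sets by auto
  have "(\<lambda>n. set_lebesgue_integral ?M (V n) f) \<longlonglongrightarrow> set_lebesgue_integral ?M (\<Inter>n. V n) f"
  proof (rule set_integral_cont_down[OF V_sets])
    show "decseq V" by (auto simp: decseq_def V_def)
    show "set_integrable ?M (V 0) f"
      unfolding set_integrable_def using f V_sets by (rule integrable_mult_indicator[rotated])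
  qed
  moreover have "set_lebesgue_integral ?M (V n) f = 0" for n
    using V_open by (intro open_zero) (auto simp: V_def)
  ultimately have "(\<lambda>n::nat. 0) \<longlonglongrightarrow> set_lebesgue_integral ?M (\<Inter>n. V n) f" by simp
  from LIMSEQ_unique[OF this tendsto_const] have "set_lebesgue_integral ?M (\<Inter>n. V n) f = 0" .
  moreover have "set_lebesgue_integral ?M A f = set_lebesgue_integral ?M (\<Inter>n. V n) f"
  proof (rule set_integral_cong_set)
    have diff_sets: "(\<Inter>n. V n) - A \<in> sets ?M"
      using Int_sets A_M by auto
    have "emeasure ?M ((\<Inter>n. V n) - A) \<le> ennreal (inverse (real (Suc n)))" for n
    proof -
      have "emeasure ?M ((\<Inter>n. V n) - A) = emeasure lebesgue ((\<Inter>n. V n) - A)"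
        using sets by (intro emeasure_restrict_space) (auto simp: V_def)
      also have "\<dots> \<le> emeasure lebesgue (T n - A)"
        using T(1) A by (intro emeasure_mono) (auto simp: V_def)
      also have "\<dots> \<le> ennreal (inverse (real (Suc n)))"
        using T(3)[of n] by simp
      finally show ?thesis .
    qed
    moreover have "(\<lambda>n. ennreal (inverse (real (Suc n)))) \<longlonglongrightarrow> ennreal 0"
      by (intro tendsto_ennrealI LIMSEQ_inverse_real_of_nat)
    ultimately have "emeasure ?M ((\<Inter>n. V n) - A) \<le> ennreal 0"
      by (intro LIMSEQ_le_const) auto
    then have "(\<Inter>n. V n) - A \<in> null_sets ?M"
      using diff_sets by (intro null_setsI) auto
    then have "AE x in ?M. x \<notin> (\<Inter>n. V n) - A" by (rule AE_not_in)
    then show "AE x in ?M. (x \<in> (\<Inter>n. V n)) = (x \<in> A)"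
      by eventually_elim (use T(2) A in \<open>auto simp: V_def\<close>)
  qed (use A_M Int_sets f in \<open>auto simp: set_borel_measurable_def\<close>)
  ultimately show "set_lebesgue_integral ?M A f = 0" by simp
qed

lemma fundamental_lemma:
  fixes f :: "'a::euclidean_space \<Rightarrow> 'b::euclidean_space"
  assumes "open \<Omega>" and fin: "\<Omega> \<in> lmeasurable" and f: "integrable (lebesgue_on \<Omega>) f"
    and orth: "\<And>\<phi>. \<phi> \<in> test_functions \<Omega> \<Longrightarrow> (LINT x|lebesgue_on \<Omega>. \<phi> x *\<^sub>R f x) = 0"
  shows "AE x in lebesgue_on \<Omega>. f x = 0"
proof -
  have "AE x in lebesgue_on \<Omega>. f x \<bullet> b = 0" for b
  proof (rule fundamental_lemma_real[OF \<open>open \<Omega>\<close> fin])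
    fix \<phi> :: "'a \<Rightarrow> real" assume \<phi>: "\<phi> \<in> test_functions \<Omega>"
    obtain B where B: "\<And>x. norm (\<phi> x) \<le> B"
      using test_function_bounded[OF \<phi>] by blast
    have "integrable (lebesgue_on \<Omega>) (\<lambda>x. \<phi> x *\<^sub>R f x)"
    proof (rule Bochner_Integration.integrable_bound)
      show "integrable (lebesgue_on \<Omega>) (\<lambda>x. B * norm (f x))"
        using f by simp
      show "AE x in lebesgue_on \<Omega>. norm (\<phi> x *\<^sub>R f x) \<le> norm (B * norm (f x))"
        using B by (intro AE_I2) (auto simp: abs_mult intro!: mult_right_mono order_trans[OF _ abs_ge_self])
    qed (use smooth_lebesgue_measurable[OF test_function_smooth[OF \<phi>]] f in measurable)
    then have "(LINT x|lebesgue_on \<Omega>. (\<phi> x *\<^sub>R f x) \<bullet> b) = (LINT x|lebesgue_on \<Omega>. \<phi> x *\<^sub>R f x) \<bullet> b"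
      by (intro integral_inner_left)
    with orth[OF \<phi>] show "(LINT x|lebesgue_on \<Omega>. \<phi> x * (f x \<bullet> b)) = 0" by simp
  qed (use f in simp)
  then have "AE x in lebesgue_on \<Omega>. \<forall>b\<in>Basis. f x \<bullet> b = 0"
    by (intro AE_finite_allI) auto
  then show ?thesis
    by eventually_elim (simp add: euclidean_all_zero_iff)
qed

lemma integration_by_parts:
  fixes \<phi> \<psi> :: "'a::euclidean_space \<Rightarrow> real"
  assumes \<Omega>: "\<Omega> \<in> lmeasurable" and \<phi>: "\<phi> \<in> test_functions \<Omega>" and \<psi>: "\<psi> \<in> test_functions \<Omega>"
  shows "(LINT x|lebesgue_on \<Omega>. \<phi> x * frechet_derivative \<psi> (at x) h)
       = - (LINT x|lebesgue_on \<Omega>. frechet_derivative \<phi> (at x) h * \<psi> x)"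
proof -
  have D: "frechet_derivative (\<lambda>x. \<phi> x * \<psi> x) (at x) h
      = \<phi> x * frechet_derivative \<psi> (at x) h + frechet_derivative \<phi> (at x) h * \<psi> x" for x
    using fun_cong[OF frechet_derivative_at[OF has_derivative_mult[OF
        smooth_has_derivative[OF test_function_smooth[OF \<phi>]]
        smooth_has_derivative[OF test_function_smooth[OF \<psi>]]]], of x h]
    by (rule sym)
  have "integrable (lebesgue_on \<Omega>) (\<lambda>x. \<phi> x * frechet_derivative \<psi> (at x) h)"
    using L2_inner_integrable[OF test_function_L2[OF \<Omega> \<phi>]
        test_function_L2[OF \<Omega> test_function_derivative[OF \<psi>]]] by simp
  moreover have "integrable (lebesgue_on \<Omega>) (\<lambda>x. frechet_derivative \<phi> (at x) h * \<psi> x)"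
    using L2_inner_integrable[OF test_function_L2[OF \<Omega> test_function_derivative[OF \<phi>]]
        test_function_L2[OF \<Omega> \<psi>]] by simp
  moreover have "(LINT x|lebesgue_on \<Omega>. frechet_derivative (\<lambda>x. \<phi> x * \<psi> x) (at x) h) = 0"
    by (rule integral_derivative_test_function[OF fmeasurableD[OF \<Omega>]
          test_function_mult[OF test_function_smooth[OF \<phi>] \<psi>]])
  ultimately show ?thesis by (simp add: D)
qed

text \<open>
  Integrate the derivative of \<open>(x \<bullet> e) \<phi>\<^sup>2\<close> in direction \<open>e\<close>. Since \<open>x \<bullet> e\<close> has derivative one, this gives
  \<open>\<parallel>\<phi>\<parallel>\<^sup>2 = - 2 ((x \<bullet> e) \<phi>, \<partial>\<^sub>e \<phi>)\<close>, and \<open>\<bar>x \<bullet> e\<bar> \<le> R\<close> on \<open>\<Omega>\<close>.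
\<close>

lemma Poincare_directional:
  fixes \<phi> :: "'a::euclidean_space \<Rightarrow> real"
  assumes \<Omega>: "\<Omega> \<in> lmeasurable" and \<phi>: "\<phi> \<in> test_functions \<Omega>"
    and e: "norm e = 1" and R: "\<And>x. x \<in> \<Omega> \<Longrightarrow> norm x \<le> R" "0 \<le> R"
  shows "l2_norm \<Omega> \<phi> \<le> 2 * R * l2_norm \<Omega> (\<lambda>x. frechet_derivative \<phi> (at x) e)"
proof -
  let ?D = "\<lambda>x. frechet_derivative \<phi> (at x) e"
  have D: "?D \<in> test_functions \<Omega>" by (rule test_function_derivative[OF \<phi>])
  have coord: "smooth (\<lambda>x::'a. x \<bullet> e)"
    by (rule smooth_bounded_linear) (rule bounded_linear_inner_left)
  define g where "g x = (x \<bullet> e) * \<phi> x" for x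
  have g: "g \<in> test_functions \<Omega>"
    unfolding g_def by (rule test_function_mult[OF coord \<phi>])
  have "(\<phi> has_derivative frechet_derivative \<phi> (at x)) (at x)" for x
    by (rule smooth_has_derivative[OF test_function_smooth[OF \<phi>]])
  then have "(g has_derivative (\<lambda>h. (x \<bullet> e) * frechet_derivative \<phi> (at x) h + (h \<bullet> e) * \<phi> x)) (at x)" for x
    unfolding g_def by (auto intro!: derivative_eq_intros)
  from fun_cong[OF frechet_derivative_at[OF this], of _ e]
  have Dg: "frechet_derivative g (at x) e = (x \<bullet> e) * ?D x + \<phi> x" for x
    using e by (simp add: dot_square_norm)
  have "l2_inner \<Omega> g ?D = - (LINT x|lebesgue_on \<Omega>. frechet_derivative g (at x) e * \<phi> x)"
    unfolding l2_inner_def using integration_by_parts[OF \<Omega> g \<phi>] by simp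
  also have "(LINT x|lebesgue_on \<Omega>. frechet_derivative g (at x) e * \<phi> x)
      = (LINT x|lebesgue_on \<Omega>. g x \<bullet> ?D x + \<phi> x \<bullet> \<phi> x)"
    by (simp add: Dg g_def algebra_simps)
  also have "\<dots> = l2_inner \<Omega> g ?D + l2_inner \<Omega> \<phi> \<phi>"
    unfolding l2_inner_def
    by (intro Bochner_Integration.integral_add L2_inner_integrable test_function_L2[OF \<Omega>] g D \<phi>)
  finally have "(l2_norm \<Omega> \<phi>)\<^sup>2 = - 2 * l2_inner \<Omega> g ?D"
    by (simp add: l2_norm_power2)
  also have "\<dots> \<le> 2 * (l2_norm \<Omega> g * l2_norm \<Omega> ?D)"
    using l2_Cauchy_Schwarz[OF test_function_L2[OF \<Omega> g] test_function_L2[OF \<Omega> D]] by linarith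
  also have "l2_norm \<Omega> g \<le> R * l2_norm \<Omega> \<phi>"
  proof (rule l2_norm_mono)
    have "norm (g x) \<le> R * norm (\<phi> x)" if "x \<in> \<Omega>" for x
    proof -
      have "\<bar>x \<bullet> e\<bar> \<le> R"
        using Cauchy_Schwarz_ineq2[of x e] R(1)[OF that] e by simp
      then show ?thesis by (simp add: g_def abs_mult mult_right_mono)
    qed
    then show "AE x in lebesgue_on \<Omega>. norm (g x) \<le> R * norm (\<phi> x)"
      using \<Omega> by (intro AE_I2) (auto simp: space_restrict_space)
  qed (use R test_function_L2[OF \<Omega> \<phi>] L2_measurable[OF test_function_L2[OF \<Omega> g]] in auto)
  finally have "(l2_norm \<Omega> \<phi>)\<^sup>2 \<le> 2 * (R * l2_norm \<Omega> \<phi> * l2_norm \<Omega> ?D)"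
    by (simp add: mult_right_mono)
  then have "l2_norm \<Omega> \<phi> * l2_norm \<Omega> \<phi> \<le> (2 * R * l2_norm \<Omega> ?D) * l2_norm \<Omega> \<phi>"
    by (simp add: power2_eq_square mult_ac)
  then show ?thesis
    using R(2) by (cases "l2_norm \<Omega> \<phi> = 0") (auto simp: mult_le_cancel_right less_le)
qed

section \<open>Test fields and weak derivatives\<close>

lemma L2_bounded_linear:
  fixes f :: "'a::euclidean_space \<Rightarrow> 'b::euclidean_space" and L :: "'b \<Rightarrow> 'c::euclidean_space"
  assumes L: "bounded_linear L" and f: "f \<in> L2 \<Omega> UNIV"
  shows "(\<lambda>x. L (f x)) \<in> L2 \<Omega> UNIV" "l2_norm \<Omega> (\<lambda>x. L (f x)) \<le> onorm L * l2_norm \<Omega> f"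
proof -
  have [measurable]: "L \<in> borel_measurable borel"
    by (intro borel_measurable_continuous_onI linear_continuous_on L)
  have meas: "(\<lambda>x. L (f x)) \<in> borel_measurable (lebesgue_on \<Omega>)"
    using L2_measurable[OF f] by measurable
  have le: "AE x in lebesgue_on \<Omega>. norm (L (f x)) \<le> onorm L * norm (f x)"
    by (intro AE_I2 onorm L)
  show "(\<lambda>x. L (f x)) \<in> L2 \<Omega> UNIV" by (rule L2_dominated[OF f meas le])
  show "l2_norm \<Omega> (\<lambda>x. L (f x)) \<le> onorm L * l2_norm \<Omega> f"
    by (rule l2_norm_mono[OF f meas le onorm_pos_le[OF L]])
qed

lemma L2_component:
  fixes f :: "'a::euclidean_space \<Rightarrow> real^'n"
  shows "f \<in> L2 \<Omega> UNIV \<Longrightarrow> (\<lambda>x. f x $ i) \<in> L2 \<Omega> UNIV"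
  by (rule L2_bounded_linear(1)[OF bounded_linear_vec_nth])

lemma L2_fst:
  fixes f :: "'a::euclidean_space \<Rightarrow> 'b::euclidean_space \<times> 'c::euclidean_space"
  shows "f \<in> L2 \<Omega> UNIV \<Longrightarrow> (\<lambda>x. fst (f x)) \<in> L2 \<Omega> UNIV"
  by (rule L2_bounded_linear(1)[OF bounded_linear_fst])

lemma L2_snd:
  fixes f :: "'a::euclidean_space \<Rightarrow> 'b::euclidean_space \<times> 'c::euclidean_space"
  shows "f \<in> L2 \<Omega> UNIV \<Longrightarrow> (\<lambda>x. snd (f x)) \<in> L2 \<Omega> UNIV"
  by (rule L2_bounded_linear(1)[OF bounded_linear_snd])

lemma L2_Pair:
  fixes f :: "'a::euclidean_space \<Rightarrow> 'b::euclidean_space" and g :: "'a \<Rightarrow> 'c::euclidean_space"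
  assumes f: "f \<in> L2 \<Omega> UNIV" and g: "g \<in> L2 \<Omega> UNIV"
  shows "(\<lambda>x. (f x, g x)) \<in> L2 \<Omega> UNIV"
proof -
  have "(\<lambda>x. (f x, 0::'c)) \<in> L2 \<Omega> UNIV" "(\<lambda>x. (0::'b, g x)) \<in> L2 \<Omega> UNIV"
    using L2_bounded_linear(1)[OF bounded_linear_Pair[OF bounded_linear_ident bounded_linear_zero] f]
      L2_bounded_linear(1)[OF bounded_linear_Pair[OF bounded_linear_zero bounded_linear_ident] g]
    by simp_all
  from L2_add[OF this] show ?thesis by simp
qed

lemma l2_inner_prod:
  fixes f g :: "'a::euclidean_space \<Rightarrow> 'b::euclidean_space \<times> 'c::euclidean_space"
  assumes "f \<in> L2 \<Omega> UNIV" and "g \<in> L2 \<Omega> UNIV"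
  shows "l2_inner \<Omega> f g
       = l2_inner \<Omega> (\<lambda>x. fst (f x)) (\<lambda>x. fst (g x)) + l2_inner \<Omega> (\<lambda>x. snd (f x)) (\<lambda>x. snd (g x))"
  unfolding l2_inner_def inner_prod_def
  by (intro Bochner_Integration.integral_add L2_inner_integrable L2_fst L2_snd assms)

lemma l2_inner_vec:
  fixes f g :: "'a::euclidean_space \<Rightarrow> real^'n"
  assumes "f \<in> L2 \<Omega> UNIV" and "g \<in> L2 \<Omega> UNIV"
  shows "l2_inner \<Omega> f g = (\<Sum>i\<in>UNIV. l2_inner \<Omega> (\<lambda>x. f x $ i) (\<lambda>x. g x $ i))"
  unfolding l2_inner_def inner_vec_def
  by (intro Bochner_Integration.integral_sum L2_inner_integrable L2_component assms)

lemma integrable_scaleR_L2: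
  fixes f :: "'a::euclidean_space \<Rightarrow> real" and g :: "'a \<Rightarrow> 'b::euclidean_space"
  assumes f: "f \<in> L2 \<Omega> UNIV" and g: "g \<in> L2 \<Omega> UNIV"
  shows "integrable (lebesgue_on \<Omega>) (\<lambda>x. f x *\<^sub>R g x)"
proof (rule Bochner_Integration.integrable_bound)
  have "(\<lambda>x. norm (g x)) \<in> L2 \<Omega> UNIV"
    using g L2_measurable[OF g] by (auto simp: L2_UNIV_iff)
  from L2_inner_integrable[OF f this]
  show "integrable (lebesgue_on \<Omega>) (\<lambda>x. f x * norm (g x))" by simp
  show "(\<lambda>x. f x *\<^sub>R g x) \<in> borel_measurable (lebesgue_on \<Omega>)"
    using L2_measurable[OF f] L2_measurable[OF g] by measurable
qed (simp add: abs_mult)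

lemma test_function_component:
  assumes "\<phi> \<in> test_functions \<Omega>"
  shows "(\<lambda>x. \<phi> x $ i) \<in> test_functions \<Omega>"
  by (rule test_function_linear[OF bounded_linear_vec_nth assms])

lemma derivative_component:
  fixes \<phi> :: "'a::euclidean_space \<Rightarrow> real^'n"
  assumes "\<phi> \<in> test_functions \<Omega>"
  shows "frechet_derivative (\<lambda>x. \<phi> x $ i) (at x) h = frechet_derivative \<phi> (at x) h $ i"
proof -
  have "((\<lambda>x. \<phi> x $ i) has_derivative (\<lambda>h. frechet_derivative \<phi> (at x) h $ i)) (at x)"
    by (rule bounded_linear.has_derivative[OF bounded_linear_vec_nth
          smooth_has_derivative[OF test_function_smooth[OF assms]]])
  from fun_cong[OF frechet_derivative_at[OF this], of h] show ?thesis by (rule sym)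
qed

lemma test_function_vec:
  fixes f :: "'n::finite \<Rightarrow> 'a::euclidean_space \<Rightarrow> real"
  assumes "\<And>i. f i \<in> test_functions \<Omega>"
  shows "(\<lambda>x. \<chi> i. f i x) \<in> test_functions \<Omega>"
proof -
  have "(\<lambda>x. \<Sum>i\<in>UNIV. f i x *\<^sub>R axis i (1::real)) \<in> test_functions \<Omega>"
    by (intro test_function_sum test_function_linear[OF bounded_linear_scaleR_left] assms)
  moreover have "(\<Sum>i\<in>UNIV. f i x *\<^sub>R axis i (1::real)) = (\<chi> i. f i x)" for x
    by (simp add: vec_eq_iff axis_def if_distrib cong: if_cong)
  ultimately show ?thesis by simp
qed

lemma test_function_gradient:
  assumes "\<phi> \<in> test_functions \<Omega>" shows "gradient \<phi> \<in> test_functions \<Omega>"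
  unfolding gradient_def[abs_def] by (intro test_function_vec test_function_derivative assms)

definition diag_deriv :: "(real^'n \<Rightarrow> real^'n) \<Rightarrow> real^'n \<Rightarrow> real^'n" where
  "diag_deriv \<phi> x = (\<chi> i. frechet_derivative \<phi> (at x) (axis i 1) $ i)"

definition classical_div :: "(real^'n \<Rightarrow> real^'n) \<Rightarrow> real^'n \<Rightarrow> real" where
  "classical_div \<phi> x = (\<Sum>i\<in>UNIV. diag_deriv \<phi> x $ i)"

lemma test_function_diag_deriv:
  assumes "\<phi> \<in> test_functions \<Omega>" shows "diag_deriv \<phi> \<in> test_functions \<Omega>"
  unfolding diag_deriv_def[abs_def]
  by (intro test_function_vec test_function_component test_function_derivative assms)

lemma test_function_classical_div:
  assumes "\<phi> \<in> test_functions \<Omega>" shows "classical_div \<phi> \<in> test_functions \<Omega>"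
  unfolding classical_div_def[abs_def]
  by (intro test_function_sum test_function_component test_function_diag_deriv assms)

lemma diag_deriv_component:
  assumes "\<phi> \<in> test_functions \<Omega>"
  shows "diag_deriv \<phi> x $ i = frechet_derivative (\<lambda>x. \<phi> x $ i) (at x) (axis i 1)"
  by (simp add: diag_deriv_def derivative_component[OF assms])

text \<open>
  The component \<open>\<phi>\<^sub>i\<close> is controlled by \<open>\<partial>\<^sub>i \<phi>\<^sub>i\<close> alone, so the diagonal of the Jacobian suffices to
  control the field. This estimate takes the place of Korn's inequality.
\<close>

lemma l2_norm_le_diag_deriv:
  fixes \<Omega> :: "(real^'n) set"
  assumes \<Omega>: "\<Omega> \<in> lmeasurable" and \<phi>: "\<phi> \<in> test_functions \<Omega>"
    and R: "\<And>x. x \<in> \<Omega> \<Longrightarrow> norm x \<le> R" "0 \<le> R"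
  shows "l2_norm \<Omega> \<phi> \<le> 2 * R * l2_norm \<Omega> (diag_deriv \<phi>)"
proof (rule power2_le_imp_le)
  have "l2_norm \<Omega> (\<lambda>x. \<phi> x $ i) \<le> 2 * R * l2_norm \<Omega> (\<lambda>x. diag_deriv \<phi> x $ i)" for i
    unfolding diag_deriv_component[OF \<phi>]
    by (rule Poincare_directional[OF \<Omega> test_function_component[OF \<phi>] _ R]) simp
  then have "(l2_norm \<Omega> (\<lambda>x. \<phi> x $ i))\<^sup>2 \<le> (2 * R * l2_norm \<Omega> (\<lambda>x. diag_deriv \<phi> x $ i))\<^sup>2" for i
    by (rule power_mono) simp
  then have "(\<Sum>i\<in>UNIV. (l2_norm \<Omega> (\<lambda>x. \<phi> x $ i))\<^sup>2)
      \<le> (\<Sum>i\<in>UNIV. (2 * R)\<^sup>2 * (l2_norm \<Omega> (\<lambda>x. diag_deriv \<phi> x $ i))\<^sup>2)"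
    by (intro sum_mono) (simp add: power_mult_distrib)
  then show "(l2_norm \<Omega> \<phi>)\<^sup>2 \<le> (2 * R * l2_norm \<Omega> (diag_deriv \<phi>))\<^sup>2"
    using l2_inner_vec[OF test_function_L2[OF \<Omega> \<phi>] test_function_L2[OF \<Omega> \<phi>]]
      l2_inner_vec[OF test_function_L2[OF \<Omega> test_function_diag_deriv[OF \<phi>]]
        test_function_L2[OF \<Omega> test_function_diag_deriv[OF \<phi>]]]
    by (simp add: l2_norm_power2 power_mult_distrib sum_distrib_left)
qed (use R in simp)

lemma l2_norm_classical_div_le:
  fixes \<Omega> :: "(real^'n) set"
  assumes \<Omega>: "\<Omega> \<in> lmeasurable" and \<phi>: "\<phi> \<in> test_functions \<Omega>"
  shows "l2_norm \<Omega> (classical_div \<phi>) \<le> real CARD('n) * l2_norm \<Omega> (diag_deriv \<phi>)"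
proof (rule l2_norm_mono)
  have "norm (classical_div \<phi> x) \<le> real CARD('n) * norm (diag_deriv \<phi> x)" for x
    unfolding classical_div_def real_norm_def
    by (rule order_trans[OF sum_abs]) (rule order_trans[OF sum_bounded_above], rule component_le_norm_cart, simp)
  then show "AE x in lebesgue_on \<Omega>. norm (classical_div \<phi> x) \<le> real CARD('n) * norm (diag_deriv \<phi> x)"
    by simp
qed (use \<Omega> \<phi> in \<open>auto intro!: test_function_L2 L2_measurable test_function_diag_deriv test_function_classical_div\<close>)

lemma AE_eq_if_orthogonal_test:
  fixes f g :: "'a::euclidean_space \<Rightarrow> 'b::euclidean_space"
  assumes "open \<Omega>" and \<Omega>: "\<Omega> \<in> lmeasurable" and f: "f \<in> L2 \<Omega> UNIV" and g: "g \<in> L2 \<Omega> UNIV"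
    and eq: "\<And>\<phi>. \<phi> \<in> test_functions \<Omega> \<Longrightarrow>
      (LINT x|lebesgue_on \<Omega>. \<phi> x *\<^sub>R f x) = (LINT x|lebesgue_on \<Omega>. \<phi> x *\<^sub>R g x)"
  shows "AE x in lebesgue_on \<Omega>. f x = g x"
proof -
  have "AE x in lebesgue_on \<Omega>. f x - g x = 0"
  proof (rule fundamental_lemma[OF \<open>open \<Omega>\<close> \<Omega> L2_integrable[OF \<Omega> L2_diff[OF f g]]])
    fix \<phi> :: "'a \<Rightarrow> real" assume \<phi>: "\<phi> \<in> test_functions \<Omega>"
    show "(LINT x|lebesgue_on \<Omega>. \<phi> x *\<^sub>R (f x - g x)) = 0"
      using eq[OF \<phi>] integrable_scaleR_L2[OF test_function_L2[OF \<Omega> \<phi>] f]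
        integrable_scaleR_L2[OF test_function_L2[OF \<Omega> \<phi>] g]
      by (simp add: scaleR_diff_right)
  qed
  then show ?thesis by simp
qed

lemma is_weak_div_unique:
  fixes \<Omega> :: "(real^'n) set"
  assumes "open \<Omega>" "\<Omega> \<in> lmeasurable" "is_weak_div \<Omega> v g" "is_weak_div \<Omega> v g'"
  shows "AE x in lebesgue_on \<Omega>. g x = g' x"
proof (rule AE_eq_if_orthogonal_test)
  fix \<phi> :: "real^'n \<Rightarrow> real" assume "\<phi> \<in> test_functions \<Omega>"
  then have "l2_inner \<Omega> g \<phi> = l2_inner \<Omega> g' \<phi>"
    using assms by (simp add: is_weak_div_def)
  then show "(LINT x|lebesgue_on \<Omega>. \<phi> x *\<^sub>R g x) = (LINT x|lebesgue_on \<Omega>. \<phi> x *\<^sub>R g' x)"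
    by (simp add: l2_inner_def mult.commute)
qed (use assms in \<open>auto simp: is_weak_div_def\<close>)

lemma is_weak_grad_unique:
  fixes \<Omega> :: "(real^'n) set"
  assumes "open \<Omega>" "\<Omega> \<in> lmeasurable" "is_weak_grad \<Omega> u g" "is_weak_grad \<Omega> u g'"
  shows "AE x in lebesgue_on \<Omega>. g x = g' x"
  by (rule AE_eq_if_orthogonal_test) (use assms in \<open>auto simp: is_weak_grad_def\<close>)

lemma is_weak_div_weak_div: "is_weak_div \<Omega> v g \<Longrightarrow> is_weak_div \<Omega> v (weak_div \<Omega> v)"
  unfolding weak_div_def by (rule someI[where P="is_weak_div \<Omega> v"])

lemma is_weak_grad_weak_grad: "is_weak_grad \<Omega> v g \<Longrightarrow> is_weak_grad \<Omega> v (weak_grad \<Omega> v)"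
  unfolding weak_grad_def by (rule someI[where P="is_weak_grad \<Omega> v"])

lemma is_weak_div_combination:
  fixes \<Omega> :: "(real^'n) set"
  assumes \<Omega>: "\<Omega> \<in> lmeasurable" and u: "u \<in> L2 \<Omega> UNIV" "is_weak_div \<Omega> u f"
    and v: "v \<in> L2 \<Omega> UNIV" "is_weak_div \<Omega> v g"
  shows "is_weak_div \<Omega> (\<lambda>x. a *\<^sub>R u x + b *\<^sub>R v x) (\<lambda>x. a * f x + b * g x)"
  unfolding is_weak_div_def
proof (intro conjI ballI)
  have f: "f \<in> L2 \<Omega> UNIV" and g: "g \<in> L2 \<Omega> UNIV"
    using u v by (auto simp: is_weak_div_def)
  show "(\<lambda>x. a * f x + b * g x) \<in> L2 \<Omega> UNIV"
    using L2_add[OF L2_scaleR[OF f] L2_scaleR[OF g], of a b] by simp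
  fix \<phi> :: "real^'n \<Rightarrow> real" assume \<phi>: "\<phi> \<in> test_functions \<Omega>"
  have L2: "\<phi> \<in> L2 \<Omega> UNIV" "gradient \<phi> \<in> L2 \<Omega> UNIV"
    by (intro test_function_L2 test_function_gradient \<Omega> \<phi>)+
  have "l2_inner \<Omega> (\<lambda>x. a *\<^sub>R u x + b *\<^sub>R v x) (gradient \<phi>)
      = a * l2_inner \<Omega> u (gradient \<phi>) + b * l2_inner \<Omega> v (gradient \<phi>)"
    using u v L2 by (simp add: l2_inner_add_left L2_scaleR l2_inner_scaleR_left)
  also have "\<dots> = a * (- l2_inner \<Omega> f \<phi>) + b * (- l2_inner \<Omega> g \<phi>)"
    using u v \<phi> by (simp add: is_weak_div_def)
  also have "\<dots> = - l2_inner \<Omega> (\<lambda>x. a *\<^sub>R f x + b *\<^sub>R g x) \<phi>"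
    using L2(1) f g by (subst l2_inner_add_left) (auto simp: L2_scaleR l2_inner_scaleR_left simp del: real_scaleR_def)
  finally show "l2_inner \<Omega> (\<lambda>x. a *\<^sub>R u x + b *\<^sub>R v x) (gradient \<phi>)
      = - l2_inner \<Omega> (\<lambda>x. a * f x + b * g x) \<phi>" by simp
qed

lemma is_weak_div_test_function:
  fixes \<Omega> :: "(real^'n) set"
  assumes \<Omega>: "\<Omega> \<in> lmeasurable" and \<phi>: "\<phi> \<in> test_functions \<Omega>"
  shows "is_weak_div \<Omega> \<phi> (classical_div \<phi>)"
  unfolding is_weak_div_def
proof (intro conjI ballI)
  show "classical_div \<phi> \<in> L2 \<Omega> UNIV"
    by (intro test_function_L2 test_function_classical_div \<Omega> \<phi>)
  fix \<psi> :: "real^'n \<Rightarrow> real" assume \<psi>: "\<psi> \<in> test_functions \<Omega>"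
  have "l2_inner \<Omega> \<phi> (gradient \<psi>) = (\<Sum>i\<in>UNIV. l2_inner \<Omega> (\<lambda>x. \<phi> x $ i) (\<lambda>x. gradient \<psi> x $ i))"
    by (intro l2_inner_vec test_function_L2 test_function_gradient \<Omega> \<phi> \<psi>)
  also have "\<dots> = (\<Sum>i\<in>UNIV. - (LINT x|lebesgue_on \<Omega>. diag_deriv \<phi> x $ i * \<psi> x))"
    using integration_by_parts[OF \<Omega> test_function_component[OF \<phi>] \<psi>]
    by (simp add: l2_inner_def gradient_def diag_deriv_component[OF \<phi>])
  also have "\<dots> = - (LINT x|lebesgue_on \<Omega>. (\<Sum>i\<in>UNIV. diag_deriv \<phi> x $ i * \<psi> x))"
  proof -
    have "integrable (lebesgue_on \<Omega>) (\<lambda>x. diag_deriv \<phi> x $ i * \<psi> x)" for i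
      using L2_inner_integrable[OF test_function_L2[OF \<Omega> test_function_component[OF test_function_diag_deriv[OF \<phi>]]]
          test_function_L2[OF \<Omega> \<psi>]] by simp
    then show ?thesis by (simp add: sum_negf)
  qed
  finally show "l2_inner \<Omega> \<phi> (gradient \<psi>) = - l2_inner \<Omega> (classical_div \<phi>) \<psi>"
    by (simp add: l2_inner_def classical_div_def sum_distrib_right)
qed

section \<open>The space \<open>H\<^sub>0(div)\<close> and its dual\<close>

lemma H0divD:
  assumes "v \<in> H0div \<Omega>"
  shows "v \<in> L2 \<Omega> UNIV" "is_weak_div \<Omega> v (weak_div \<Omega> v)" "weak_div \<Omega> v \<in> L2 \<Omega> UNIV"
    and "\<And>u. u \<in> H1 \<Omega> \<Longrightarrow> l2_inner \<Omega> v (weak_grad \<Omega> u) + l2_inner \<Omega> (weak_div \<Omega> v) u = 0"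
proof -
  show "v \<in> L2 \<Omega> UNIV" using assms by (simp add: H0div_def Hdiv_def)
  show "is_weak_div \<Omega> v (weak_div \<Omega> v)"
    using assms is_weak_div_weak_div by (auto simp: H0div_def Hdiv_def)
  then show "weak_div \<Omega> v \<in> L2 \<Omega> UNIV" by (simp add: is_weak_div_def)
  show "l2_inner \<Omega> v (weak_grad \<Omega> u) + l2_inner \<Omega> (weak_div \<Omega> v) u = 0" if "u \<in> H1 \<Omega>" for u
    using assms that by (simp add: H0div_def normal_trace_def)
qed

lemma H1D:
  assumes "u \<in> H1 \<Omega>"
  shows "u \<in> L2 \<Omega> UNIV" "is_weak_grad \<Omega> u (weak_grad \<Omega> u)" "weak_grad \<Omega> u \<in> L2 \<Omega> UNIV"
proof -
  show "u \<in> L2 \<Omega> UNIV" using assms by (simp add: H1_def)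
  show "is_weak_grad \<Omega> u (weak_grad \<Omega> u)"
    using assms is_weak_grad_weak_grad by (auto simp: H1_def)
  then show "weak_grad \<Omega> u \<in> L2 \<Omega> UNIV" by (simp add: is_weak_grad_def)
qed

lemma weak_div_eqI:
  assumes "open \<Omega>" "\<Omega> \<in> lmeasurable" "is_weak_div \<Omega> v g"
  shows "AE x in lebesgue_on \<Omega>. weak_div \<Omega> v x = g x"
  using is_weak_div_unique[OF assms(1,2) is_weak_div_weak_div[OF assms(3)] assms(3)] .

lemma H0div_combination:
  fixes \<Omega> :: "(real^'n) set"
  assumes "open \<Omega>" and \<Omega>: "\<Omega> \<in> lmeasurable" and u: "u \<in> H0div \<Omega>" and v: "v \<in> H0div \<Omega>"
  shows "(\<lambda>x. a *\<^sub>R u x + b *\<^sub>R v x) \<in> H0div \<Omega>"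
    and "AE x in lebesgue_on \<Omega>. weak_div \<Omega> (\<lambda>x. a *\<^sub>R u x + b *\<^sub>R v x) x
      = a *\<^sub>R weak_div \<Omega> u x + b *\<^sub>R weak_div \<Omega> v x"
proof -
  let ?w = "\<lambda>x. a *\<^sub>R u x + b *\<^sub>R v x"
  let ?g = "\<lambda>x. a *\<^sub>R weak_div \<Omega> u x + b *\<^sub>R weak_div \<Omega> v x"
  note u = H0divD[OF u] and v = H0divD[OF v]
  have div: "is_weak_div \<Omega> ?w ?g"
    using is_weak_div_combination[OF \<Omega> u(1,2) v(1,2)] by simp
  then show ae: "AE x in lebesgue_on \<Omega>. weak_div \<Omega> ?w x = ?g x"
    by (rule weak_div_eqI[OF assms(1,2)])
  have w: "?w \<in> L2 \<Omega> UNIV" by (intro L2_add L2_scaleR u v)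
  have g: "?g \<in> L2 \<Omega> UNIV" using div by (simp add: is_weak_div_def)
  have wd: "weak_div \<Omega> ?w \<in> L2 \<Omega> UNIV"
    using is_weak_div_weak_div[OF div] by (simp add: is_weak_div_def)
  have "normal_trace \<Omega> ?w z = 0" if z: "z \<in> H1 \<Omega>" for z
  proof -
    note z' = H1D[OF z]
    have "l2_inner \<Omega> (weak_div \<Omega> ?w) z = l2_inner \<Omega> ?g z"
      using ae by (intro l2_inner_cong_AE wd g z') auto
    also have "\<dots> = a * l2_inner \<Omega> (weak_div \<Omega> u) z + b * l2_inner \<Omega> (weak_div \<Omega> v) z"
      using u v z' by (subst l2_inner_add_left) (auto simp: L2_scaleR l2_inner_scaleR_left simp del: real_scaleR_def)
    finally have "normal_trace \<Omega> ?w z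
        = a * (l2_inner \<Omega> u (weak_grad \<Omega> z) + l2_inner \<Omega> (weak_div \<Omega> u) z)
        + b * (l2_inner \<Omega> v (weak_grad \<Omega> z) + l2_inner \<Omega> (weak_div \<Omega> v) z)"
      using u v z' by (simp add: normal_trace_def l2_inner_add_left L2_scaleR l2_inner_scaleR_left algebra_simps)
    then show ?thesis using u(4)[OF z] v(4)[OF z] by simp
  qed
  then show "?w \<in> H0div \<Omega>"
    using w div by (auto simp: H0div_def Hdiv_def)
qed

text \<open>
  Testing the weak gradient of \<open>u\<close> with the components of \<open>\<phi>\<close> and summing gives Green's formula without
  boundary term.
\<close>

lemma test_function_H0div:
  fixes \<Omega> :: "(real^'n) set"
  assumes "open \<Omega>" and \<Omega>: "\<Omega> \<in> lmeasurable" and \<phi>: "\<phi> \<in> test_functions \<Omega>"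
  shows "\<phi> \<in> H0div \<Omega>"
proof -
  note div = is_weak_div_test_function[OF \<Omega> \<phi>]
  note \<phi>L2 = test_function_L2[OF \<Omega> \<phi>]
  have "normal_trace \<Omega> \<phi> u = 0" if u: "u \<in> H1 \<Omega>" for u
  proof -
    note u' = H1D[OF u]
    let ?G = "weak_grad \<Omega> u"
    have part: "(LINT x|lebesgue_on \<Omega>. diag_deriv \<phi> x $ i * u x) = - l2_inner \<Omega> (\<lambda>x. \<phi> x $ i) (\<lambda>x. ?G x $ i)"
      for i
    proof -
      let ?\<psi> = "\<lambda>x. \<phi> x $ i"
      have \<psi>: "?\<psi> \<in> test_functions \<Omega>" by (rule test_function_component[OF \<phi>])
      have "integrable (lebesgue_on \<Omega>) (\<lambda>x. u x *\<^sub>R gradient ?\<psi> x)"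
        "integrable (lebesgue_on \<Omega>) (\<lambda>x. ?\<psi> x *\<^sub>R ?G x)"
        by (intro integrable_scaleR_L2 u' test_function_L2[OF \<Omega>] test_function_gradient \<psi>)+
      note bl = this[THEN integral_bounded_linear[OF bounded_linear_vec_nth, of _ _ i]]
      have "(LINT x|lebesgue_on \<Omega>. u x *\<^sub>R gradient ?\<psi> x) = - (LINT x|lebesgue_on \<Omega>. ?\<psi> x *\<^sub>R ?G x)"
        using u'(2) \<psi> by (simp add: is_weak_grad_def)
      then have "(LINT x|lebesgue_on \<Omega>. u x *\<^sub>R gradient ?\<psi> x) $ i = - ((LINT x|lebesgue_on \<Omega>. ?\<psi> x *\<^sub>R ?G x) $ i)"
        by simp
      with bl show ?thesis
        by (simp add: l2_inner_def gradient_def diag_deriv_component[OF \<phi>] mult.commute)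
    qed
    have "l2_inner \<Omega> (weak_div \<Omega> \<phi>) u = l2_inner \<Omega> (classical_div \<phi>) u"
      using weak_div_eqI[OF assms(1,2) div] is_weak_div_weak_div[OF div] div u'
      by (intro l2_inner_cong_AE) (auto simp: is_weak_div_def)
    also have "\<dots> = (\<Sum>i\<in>UNIV. (LINT x|lebesgue_on \<Omega>. diag_deriv \<phi> x $ i * u x))"
    proof -
      have "integrable (lebesgue_on \<Omega>) (\<lambda>x. diag_deriv \<phi> x $ i * u x)" for i
        using L2_inner_integrable[OF test_function_L2[OF \<Omega> test_function_component[OF test_function_diag_deriv[OF \<phi>]]]
            u'(1)] by simp
      then show ?thesis by (simp add: l2_inner_def classical_div_def sum_distrib_right)
    qed
    also have "\<dots> = - l2_inner \<Omega> \<phi> ?G"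
      by (simp add: part l2_inner_vec[OF \<phi>L2 u'(3)] sum_negf)
    finally show ?thesis by (simp add: normal_trace_def)
  qed
  then show ?thesis
    using \<phi>L2 div by (auto simp: H0div_def Hdiv_def)
qed

lemma Hdiv_norm_eq:
  assumes "v \<in> H0div \<Omega>"
  shows "Hdiv_norm \<Omega> v = l2_norm \<Omega> (\<lambda>x. (v x, weak_div \<Omega> v x))"
  using l2_inner_prod[of "\<lambda>x. (v x, weak_div \<Omega> v x)" \<Omega> "\<lambda>x. (v x, weak_div \<Omega> v x)"]
    L2_Pair[OF H0divD(1)[OF assms] H0divD(3)[OF assms]]
  by (simp add: Hdiv_norm_def l2_norm_power2) (simp add: l2_norm_def)

lemma Hdiv_norm_nonneg [simp]: "0 \<le> Hdiv_norm \<Omega> v"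
  by (simp add: Hdiv_norm_def)

lemma H0div_dual_combination:
  fixes \<Omega> :: "(real^'n) set"
  assumes "open \<Omega>" "\<Omega> \<in> lmeasurable" and F: "F \<in> H0div_dual \<Omega>" and u: "u \<in> H0div \<Omega>" and v: "v \<in> H0div \<Omega>"
  shows "F (\<lambda>x. a *\<^sub>R u x + b *\<^sub>R v x) = a * F u + b * F v"
proof -
  have "(\<lambda>x. a *\<^sub>R u x) \<in> H0div \<Omega>" "(\<lambda>x. b *\<^sub>R v x) \<in> H0div \<Omega>"
    using H0div_combination(1)[OF assms(1,2) u u, of a 0] H0div_combination(1)[OF assms(1,2) v v, of b 0]
    by simp_all
  moreover have "\<forall>u\<in>H0div \<Omega>. \<forall>v\<in>H0div \<Omega>. F (\<lambda>x. u x + v x) = F u + F v"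
    using F by (simp add: H0div_dual_def)
  ultimately have "F (\<lambda>x. a *\<^sub>R u x + b *\<^sub>R v x) = F (\<lambda>x. a *\<^sub>R u x) + F (\<lambda>x. b *\<^sub>R v x)"
    by (metis (no_types))
  then show ?thesis using F u v by (simp add: H0div_dual_def)
qed

lemma zero_H0div:
  fixes \<Omega> :: "(real^'n) set"
  assumes "open \<Omega>" "\<Omega> \<in> lmeasurable" shows "(\<lambda>x. 0) \<in> H0div \<Omega>"
  by (rule test_function_H0div[OF assms test_function_zero])

lemma Hdiv_norm_scaleR:
  fixes \<Omega> :: "(real^'n) set"
  assumes "open \<Omega>" "\<Omega> \<in> lmeasurable" and v: "v \<in> H0div \<Omega>"
  shows "Hdiv_norm \<Omega> (\<lambda>x. c *\<^sub>R v x) = \<bar>c\<bar> * Hdiv_norm \<Omega> v"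
proof -
  let ?w = "\<lambda>x. c *\<^sub>R v x + 0 *\<^sub>R v x"
  note w = H0div_combination[OF assms(1,2) v v, of c 0]
  have "Hdiv_norm \<Omega> ?w = l2_norm \<Omega> (\<lambda>x. (?w x, weak_div \<Omega> ?w x))"
    by (rule Hdiv_norm_eq[OF w(1)])
  also have "\<dots> = l2_norm \<Omega> (\<lambda>x. c *\<^sub>R (v x, weak_div \<Omega> v x))"
  proof (rule l2_norm_cong_AE)
    show "AE x in lebesgue_on \<Omega>. (?w x, weak_div \<Omega> ?w x) = c *\<^sub>R (v x, weak_div \<Omega> v x)"
      using w(2) by eventually_elim simp
  qed (intro L2_scaleR L2_Pair H0divD[OF w(1)] H0divD[OF v])+
  also have "\<dots> = \<bar>c\<bar> * Hdiv_norm \<Omega> v"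
    by (simp only: l2_norm_scaleR Hdiv_norm_eq[OF v])
  finally show ?thesis by simp
qed

lemma dual_norm_bound:
  fixes \<Omega> :: "(real^'n) set"
  assumes "open \<Omega>" "\<Omega> \<in> lmeasurable" and F: "F \<in> H0div_dual \<Omega>"
  shows "0 \<le> dual_norm \<Omega> F" and "v \<in> H0div \<Omega> \<Longrightarrow> \<bar>F v\<bar> \<le> dual_norm \<Omega> F * Hdiv_norm \<Omega> v"
proof -
  let ?S = "{\<bar>F v\<bar> |v. v \<in> H0div \<Omega> \<and> Hdiv_norm \<Omega> v \<le> 1}"
  have "\<exists>K. \<forall>v\<in>H0div \<Omega>. \<bar>F v\<bar> \<le> K * Hdiv_norm \<Omega> v"
    using F by (simp add: H0div_dual_def)
  then obtain K where K: "\<And>v. v \<in> H0div \<Omega> \<Longrightarrow> \<bar>F v\<bar> \<le> K * Hdiv_norm \<Omega> v"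
    by blast
  have "\<bar>F v\<bar> \<le> \<bar>K\<bar>" if "v \<in> H0div \<Omega>" "Hdiv_norm \<Omega> v \<le> 1" for v
  proof -
    have "\<bar>F v\<bar> \<le> \<bar>K\<bar> * Hdiv_norm \<Omega> v"
      using K[OF that(1)] by (meson Hdiv_norm_nonneg abs_ge_self mult_right_mono order_trans)
    also have "\<dots> \<le> \<bar>K\<bar> * 1" using that by (intro mult_left_mono) auto
    finally show ?thesis by simp
  qed
  then have bdd: "bdd_above ?S" by (auto simp: bdd_above_def)
  have unit: "\<bar>F v\<bar> \<le> dual_norm \<Omega> F" if "v \<in> H0div \<Omega>" "Hdiv_norm \<Omega> v \<le> 1" for v
    unfolding dual_norm_def using that by (intro cSup_upper bdd) blast
  have zero: "Hdiv_norm \<Omega> (\<lambda>x. 0) \<le> 1"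
    using Hdiv_norm_scaleR[OF assms(1,2) zero_H0div[OF assms(1,2)], of 0] by simp
  have "\<bar>F (\<lambda>x. 0)\<bar> \<le> dual_norm \<Omega> F"
    using zero_H0div[OF assms(1,2)] zero by (rule unit)
  then show "0 \<le> dual_norm \<Omega> F" by linarith
  assume v: "v \<in> H0div \<Omega>"
  show "\<bar>F v\<bar> \<le> dual_norm \<Omega> F * Hdiv_norm \<Omega> v"
  proof (cases "Hdiv_norm \<Omega> v = 0")
    case True
    then show ?thesis using K[OF v] by simp
  next
    case False
    let ?c = "inverse (Hdiv_norm \<Omega> v)"
    have pos: "0 < Hdiv_norm \<Omega> v" using False by (simp add: less_le)
    have cv: "(\<lambda>x. ?c *\<^sub>R v x) \<in> H0div \<Omega>"
      using H0div_combination(1)[OF assms(1,2) v v, of ?c 0] by simp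
    have "Hdiv_norm \<Omega> (\<lambda>x. ?c *\<^sub>R v x) \<le> 1"
      using Hdiv_norm_scaleR[OF assms(1,2) v, of ?c] False by simp
    from unit[OF cv this] have "\<bar>?c * F v\<bar> \<le> dual_norm \<Omega> F"
      using H0div_dual_combination[OF assms(1,2) F v v, of ?c 0] by simp
    then show ?thesis using pos by (simp add: abs_mult field_simps)
  qed
qed

lemma dual_norm_le:
  fixes \<Omega> :: "(real^'n) set"
  assumes "open \<Omega>" "\<Omega> \<in> lmeasurable" and "0 \<le> K"
    and K: "\<And>v. v \<in> H0div \<Omega> \<Longrightarrow> \<bar>F v\<bar> \<le> K * Hdiv_norm \<Omega> v"
  shows "dual_norm \<Omega> F \<le> K"
  unfolding dual_norm_def
proof (rule cSup_least)
  have "Hdiv_norm \<Omega> (\<lambda>x. 0) \<le> 1"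
    using Hdiv_norm_scaleR[OF assms(1,2) zero_H0div[OF assms(1,2)], of 0] by simp
  then show "{\<bar>F v\<bar> |v. v \<in> H0div \<Omega> \<and> Hdiv_norm \<Omega> v \<le> 1} \<noteq> {}"
    using zero_H0div[OF assms(1,2)] by blast
  fix y assume "y \<in> {\<bar>F v\<bar> |v. v \<in> H0div \<Omega> \<and> Hdiv_norm \<Omega> v \<le> 1}"
  then obtain v where v: "v \<in> H0div \<Omega>" "Hdiv_norm \<Omega> v \<le> 1" "y = \<bar>F v\<bar>" by blast
  have "y \<le> K * Hdiv_norm \<Omega> v" using K v by simp
  also have "\<dots> \<le> K * 1" using v \<open>0 \<le> K\<close> by (intro mult_left_mono) auto
  finally show "y \<le> K" by simp
qed

lemma H0div_dualI:
  assumes "\<And>u v a b. u \<in> H0div \<Omega> \<Longrightarrow> v \<in> H0div \<Omega> \<Longrightarrow> F (\<lambda>x. a *\<^sub>R u x + b *\<^sub>R v x) = a * F u + b * F v"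
    and "\<And>v. v \<in> H0div \<Omega> \<Longrightarrow> \<bar>F v\<bar> \<le> K * Hdiv_norm \<Omega> v"
    and "\<And>v. v \<notin> H0div \<Omega> \<Longrightarrow> F v = 0"
  shows "F \<in> H0div_dual \<Omega>"
  unfolding H0div_dual_def
proof (intro CollectI conjI ballI allI impI)
  show "F (\<lambda>x. u x + v x) = F u + F v" if "u \<in> H0div \<Omega>" "v \<in> H0div \<Omega>" for u v
    using assms(1)[OF that, of 1 1] by simp
  show "F (\<lambda>x. c *\<^sub>R v x) = c * F v" if "v \<in> H0div \<Omega>" for c v
    using assms(1)[OF that that, of c 0] by simp
qed (use assms(2,3) in blast)+

lemma H0div_dual_lincomb:
  fixes \<Omega> :: "(real^'n) set"
  assumes "open \<Omega>" "\<Omega> \<in> lmeasurable" and F: "F \<in> H0div_dual \<Omega>" and G: "G \<in> H0div_dual \<Omega>"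
  shows "(\<lambda>v. F v + c * G v) \<in> H0div_dual \<Omega>"
proof (rule H0div_dualI)
  show "F (\<lambda>x. a *\<^sub>R u x + b *\<^sub>R v x) + c * G (\<lambda>x. a *\<^sub>R u x + b *\<^sub>R v x)
      = a * (F u + c * G u) + b * (F v + c * G v)" if "u \<in> H0div \<Omega>" "v \<in> H0div \<Omega>" for u v a b
    using that H0div_dual_combination[OF assms(1,2) F] H0div_dual_combination[OF assms(1,2) G]
    by (simp add: algebra_simps)
  show "\<bar>F v + c * G v\<bar> \<le> (dual_norm \<Omega> F + \<bar>c\<bar> * dual_norm \<Omega> G) * Hdiv_norm \<Omega> v"
    if v: "v \<in> H0div \<Omega>" for v
  proof -
    have "\<bar>F v + c * G v\<bar> \<le> \<bar>F v\<bar> + \<bar>c\<bar> * \<bar>G v\<bar>"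
      by (simp add: order_trans[OF abs_triangle_ineq] abs_mult)
    also have "\<dots> \<le> dual_norm \<Omega> F * Hdiv_norm \<Omega> v + \<bar>c\<bar> * (dual_norm \<Omega> G * Hdiv_norm \<Omega> v)"
      by (intro add_mono mult_left_mono dual_norm_bound assms v) auto
    finally show ?thesis by (simp add: algebra_simps)
  qed
qed (use F G in \<open>simp add: H0div_dual_def\<close>)

lemma dual_grad_in_dual:
  fixes \<Omega> :: "(real^'n) set"
  assumes "open \<Omega>" "\<Omega> \<in> lmeasurable" and q: "q \<in> L2 \<Omega> UNIV"
  shows "dual_grad \<Omega> q \<in> H0div_dual \<Omega>" and "dual_norm \<Omega> (dual_grad \<Omega> q) \<le> l2_norm \<Omega> q"
proof -
  have bound: "\<bar>dual_grad \<Omega> q v\<bar> \<le> l2_norm \<Omega> q * Hdiv_norm \<Omega> v" if v: "v \<in> H0div \<Omega>" for v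
  proof -
    have "\<bar>dual_grad \<Omega> q v\<bar> \<le> l2_norm \<Omega> q * l2_norm \<Omega> (weak_div \<Omega> v)"
      using l2_Cauchy_Schwarz[OF q H0divD(3)[OF v]] v by (simp add: dual_grad_def)
    also have "l2_norm \<Omega> (weak_div \<Omega> v) \<le> Hdiv_norm \<Omega> v"
      unfolding Hdiv_norm_def by (rule real_le_rsqrt) simp
    finally show ?thesis by (simp add: mult_left_mono)
  qed
  show "dual_grad \<Omega> q \<in> H0div_dual \<Omega>"
  proof (rule H0div_dualI[OF _ bound])
    fix u v a b assume u: "u \<in> H0div \<Omega>" and v: "v \<in> H0div \<Omega>"
    let ?w = "\<lambda>x. a *\<^sub>R u x + b *\<^sub>R v x"
    note w = H0div_combination[OF assms(1,2) u v, of a b]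
    have "l2_inner \<Omega> q (weak_div \<Omega> ?w) = l2_inner \<Omega> q (\<lambda>x. a *\<^sub>R weak_div \<Omega> u x + b *\<^sub>R weak_div \<Omega> v x)"
      using w(2) by (intro l2_inner_cong_AE q H0divD(3)[OF w(1)] L2_add L2_scaleR H0divD(3)[OF u] H0divD(3)[OF v]) auto
    also have "\<dots> = a * l2_inner \<Omega> q (weak_div \<Omega> u) + b * l2_inner \<Omega> q (weak_div \<Omega> v)"
      using q H0divD(3)[OF u] H0divD(3)[OF v]
      by (subst l2_inner_add_right) (auto simp: L2_scaleR l2_inner_scaleR_right simp del: real_scaleR_def)
    finally show "dual_grad \<Omega> q ?w = a * dual_grad \<Omega> q u + b * dual_grad \<Omega> q v"
      using u v w(1) by (simp add: dual_grad_def algebra_simps)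
  qed (auto simp: dual_grad_def)
  show "dual_norm \<Omega> (dual_grad \<Omega> q) \<le> l2_norm \<Omega> q"
    by (rule dual_norm_le[OF assms(1,2) _ bound]) auto
qed

text \<open>
  This is the density of test fields in \<open>H\<^sub>0(div)\<close> in dual form: the annihilator of the test fields
  consists of the pairs \<open>(f, g)\<close> with \<open>f = \<nabla> g\<close>, and these annihilate \<open>H\<^sub>0(div)\<close> by the definition of the
  vanishing normal trace.
\<close>

lemma H0div_dual_eq_zero_if_test_zero:
  fixes \<Omega> :: "(real^'n) set"
  assumes "open \<Omega>" and \<Omega>: "\<Omega> \<in> lmeasurable" and F: "F \<in> H0div_dual \<Omega>"
    and zero: "\<And>\<phi>. \<phi> \<in> test_functions \<Omega> \<Longrightarrow> F \<phi> = 0"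
  shows "F v = 0"
proof (cases "v \<in> H0div \<Omega>")
  case v: True
  let ?T = "\<lambda>v x. (v x, weak_div \<Omega> v x)"
  have T: "?T v \<in> L2 \<Omega> UNIV" if "v \<in> H0div \<Omega>" for v
    by (intro L2_Pair H0divD[OF that])
  obtain r where r: "r \<in> L2 \<Omega> UNIV" "\<And>v. v \<in> H0div \<Omega> \<Longrightarrow> F v = l2_inner \<Omega> r (?T v)"
  proof (rule L2_Riesz[OF \<Omega>, of "H0div \<Omega>" ?T F "dual_norm \<Omega> F"])
    show "H0div \<Omega> \<noteq> {}" using v by blast
    show "\<bar>F u\<bar> \<le> dual_norm \<Omega> F * l2_norm \<Omega> (?T u)" if "u \<in> H0div \<Omega>" for u
      using dual_norm_bound(2)[OF assms(1,2) F that] Hdiv_norm_eq[OF that] by simp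
    show "\<exists>k\<in>H0div \<Omega>. F k = a * F i + b * F j \<and>
        (AE x in lebesgue_on \<Omega>. ?T k x = a *\<^sub>R ?T i x + b *\<^sub>R ?T j x)"
      if "i \<in> H0div \<Omega>" "j \<in> H0div \<Omega>" for i j a b
    proof (intro bexI conjI)
      show "F (\<lambda>x. a *\<^sub>R i x + b *\<^sub>R j x) = a * F i + b * F j"
        by (rule H0div_dual_combination[OF assms(1,2) F that])
      show "AE x in lebesgue_on \<Omega>. ?T (\<lambda>x. a *\<^sub>R i x + b *\<^sub>R j x) x = a *\<^sub>R ?T i x + b *\<^sub>R ?T j x"
        using H0div_combination(2)[OF assms(1,2) that] by eventually_elim simp
    qed (rule H0div_combination(1)[OF assms(1,2) that])
  qed (use T dual_norm_bound(1)[OF assms(1,2) F] in auto)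
  define f where "f x = fst (r x)" for x
  define g where "g x = snd (r x)" for x
  have f: "f \<in> L2 \<Omega> UNIV" and g: "g \<in> L2 \<Omega> UNIV"
    unfolding f_def g_def using r(1) by (auto intro: L2_fst L2_snd)
  have repr: "F v = l2_inner \<Omega> f v + l2_inner \<Omega> g (weak_div \<Omega> v)" if "v \<in> H0div \<Omega>" for v
    using r(2)[OF that] l2_inner_prod[OF r(1) T[OF that]] by (simp add: f_def[abs_def] g_def[abs_def])
  have "is_weak_grad \<Omega> g f"
    unfolding is_weak_grad_def
  proof (intro conjI ballI f)
    fix \<psi> :: "real^'n \<Rightarrow> real" assume \<psi>: "\<psi> \<in> test_functions \<Omega>"
    have "(LINT x|lebesgue_on \<Omega>. g x *\<^sub>R gradient \<psi> x) $ i = - ((LINT x|lebesgue_on \<Omega>. \<psi> x *\<^sub>R f x) $ i)" for i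
    proof -
      \<comment> \<open>The field \<open>\<psi> e\<^sub>i\<close> has divergence \<open>\<partial>\<^sub>i \<psi>\<close>, so testing \<open>F\<close> with it isolates the \<open>i\<close>-th component.\<close>
      define \<phi> where "\<phi> x = \<psi> x *\<^sub>R axis i (1::real)" for x
      have \<phi>: "\<phi> \<in> test_functions \<Omega>"
        unfolding \<phi>_def by (rule test_function_linear[OF bounded_linear_scaleR_left \<psi>])
      have "\<And>x. (\<phi> has_derivative (\<lambda>h. frechet_derivative \<psi> (at x) h *\<^sub>R axis i 1)) (at x)"
        unfolding \<phi>_def
        by (rule bounded_linear.has_derivative[OF bounded_linear_scaleR_left
              smooth_has_derivative[OF test_function_smooth[OF \<psi>]]])
      from fun_cong[OF frechet_derivative_at[OF this]]
      have "frechet_derivative \<phi> (at x) h = frechet_derivative \<psi> (at x) h *\<^sub>R axis i 1" for x h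
        by (rule sym)
      then have div: "classical_div \<phi> x = gradient \<psi> x $ i" for x
        by (simp add: classical_div_def diag_deriv_def gradient_def axis_def if_distrib cong: if_cong)
      have "0 = l2_inner \<Omega> f \<phi> + l2_inner \<Omega> g (weak_div \<Omega> \<phi>)"
        using zero[OF \<phi>] repr[OF test_function_H0div[OF assms(1,2) \<phi>]] by simp
      also have "l2_inner \<Omega> g (weak_div \<Omega> \<phi>) = l2_inner \<Omega> g (classical_div \<phi>)"
        using weak_div_eqI[OF assms(1,2) is_weak_div_test_function[OF \<Omega> \<phi>]]
          H0divD(3)[OF test_function_H0div[OF assms(1,2) \<phi>]] g
          test_function_L2[OF \<Omega> test_function_classical_div[OF \<phi>]]
        by (intro l2_inner_cong_AE) auto
      finally have eq: "(LINT x|lebesgue_on \<Omega>. g x * gradient \<psi> x $ i) = - (LINT x|lebesgue_on \<Omega>. \<psi> x * f x $ i)"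
        by (simp add: l2_inner_def div \<phi>_def inner_axis mult.commute)
      have "integrable (lebesgue_on \<Omega>) (\<lambda>x. g x *\<^sub>R gradient \<psi> x)"
        "integrable (lebesgue_on \<Omega>) (\<lambda>x. \<psi> x *\<^sub>R f x)"
        by (intro integrable_scaleR_L2 f g test_function_L2[OF \<Omega>] test_function_gradient \<psi>)+
      note this[THEN integral_bounded_linear[OF bounded_linear_vec_nth, of _ _ i]]
      with eq show ?thesis by simp
    qed
    then show "(LINT x|lebesgue_on \<Omega>. g x *\<^sub>R gradient \<psi> x) = - (LINT x|lebesgue_on \<Omega>. \<psi> x *\<^sub>R f x)"
      by (simp add: vec_eq_iff)
  qed
  then have "g \<in> H1 \<Omega>" using g by (auto simp: H1_def)
  have "F v = l2_inner \<Omega> v (weak_grad \<Omega> g) + l2_inner \<Omega> (weak_div \<Omega> v) g"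
  proof -
    have "l2_inner \<Omega> v f = l2_inner \<Omega> v (weak_grad \<Omega> g)"
      using is_weak_grad_unique[OF assms(1,2) \<open>is_weak_grad \<Omega> g f\<close> H1D(2)[OF \<open>g \<in> H1 \<Omega>\<close>]]
        H0divD(1)[OF v] f H1D(3)[OF \<open>g \<in> H1 \<Omega>\<close>]
      by (intro l2_inner_cong_AE) auto
    then show ?thesis
      using repr[OF v] by (simp add: l2_inner_commute)
  qed
  then show ?thesis
    using H0divD(4)[OF v \<open>g \<in> H1 \<Omega>\<close>] by simp
qed (use F in \<open>simp add: H0div_dual_def\<close>)

lemma dual_div_eqI:
  fixes \<Omega> :: "(real^'n) set"
  assumes "open \<Omega>" "\<Omega> \<in> lmeasurable" and F: "is_dual_div \<Omega> \<tau> F"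
  shows "dual_div \<Omega> \<tau> = F"
  unfolding dual_div_def
proof (rule the_equality[where P="is_dual_div \<Omega> \<tau>", OF F])
  fix G assume G: "is_dual_div \<Omega> \<tau> G"
  have "(\<lambda>v. G v + (-1) * F v) \<in> H0div_dual \<Omega>"
    using F G by (intro H0div_dual_lincomb assms(1,2)) (auto simp: is_dual_div_def)
  from H0div_dual_eq_zero_if_test_zero[OF assms(1,2) this]
  have "G v + (-1) * F v = 0" for v
    using F G by (simp add: is_dual_div_def)
  then show "G = F" by (simp add: fun_eq_iff)
qed

section \<open>The decomposition\<close>

text \<open>
  Removing the mean value is an orthogonal projection, hence does not increase the norm.
\<close>

lemma L2_zero_mean_projection:
  fixes q :: "'a::euclidean_space \<Rightarrow> real"
  assumes \<Omega>: "\<Omega> \<in> lmeasurable" and q: "q \<in> L2 \<Omega> UNIV"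
  obtains m where "(\<lambda>x. q x - m) \<in> L2_zero_mean \<Omega>" "l2_norm \<Omega> (\<lambda>x. q x - m) \<le> l2_norm \<Omega> q"
proof
  let ?\<mu> = "measure lebesgue \<Omega>"
  define I where "I = (LINT x|lebesgue_on \<Omega>. q x)"
  \<comment> \<open>If \<open>\<Omega>\<close> is a null set, then this is zero, and so is \<open>I\<close>.\<close>
  define m where "m = I / ?\<mu>"
  have c: "(\<lambda>x. m) \<in> L2 \<Omega> UNIV" by (rule L2_const[OF \<Omega>])
  have int: "integrable (lebesgue_on \<Omega>) q" "integrable (lebesgue_on \<Omega>) (\<lambda>x. m)"
    using L2_integrable[OF \<Omega> q] L2_integrable[OF \<Omega> c] by auto
  have measure: "measure (lebesgue_on \<Omega>) \<Omega> = ?\<mu>"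
    using \<Omega> by (simp add: measure_restrict_space fmeasurableD)
  have I: "m * ?\<mu> = I"
  proof (cases "?\<mu> = 0")
    case True
    have "\<bar>I\<bar> \<le> (LINT x|lebesgue_on \<Omega>. norm (q x))"
      unfolding I_def real_norm_def[symmetric] by (rule integral_norm_bound)
    also have "\<dots> \<le> 0"
      using L1_le_l2_norm[OF \<Omega> q] True by simp
    finally show ?thesis using True by simp
  qed (simp add: m_def)
  have "(LINT x|lebesgue_on \<Omega>. q x - m) = 0"
    using int I by (simp add: I_def measure mult.commute)
  then show "(\<lambda>x. q x - m) \<in> L2_zero_mean \<Omega>"
    using L2_diff[OF q c] by (simp add: L2_zero_mean_def)
  have "(l2_norm \<Omega> (\<lambda>x. q x - m))\<^sup>2 = (l2_norm \<Omega> q)\<^sup>2 - 2 * (m * I) + m\<^sup>2 * ?\<mu>"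
  proof -
    have "(l2_norm \<Omega> (\<lambda>x. m))\<^sup>2 = m\<^sup>2 * ?\<mu>" "l2_inner \<Omega> q (\<lambda>x. m) = m * I"
      unfolding l2_norm_power2 by (simp_all add: l2_inner_def I_def measure power2_eq_square)
    then show ?thesis by (simp add: l2_norm_power2_diff[OF q c])
  qed
  also have "\<dots> = (l2_norm \<Omega> q)\<^sup>2 - m\<^sup>2 * ?\<mu>"
    using I by (simp add: power2_eq_square algebra_simps)
  also have "\<dots> \<le> (l2_norm \<Omega> q)\<^sup>2" by simp
  finally show "l2_norm \<Omega> (\<lambda>x. q x - m) \<le> l2_norm \<Omega> q"
    by (rule power2_le_imp_le) simp
qed

text \<open>
  The value \<open>w \<phi>\<close> is bounded by a multiple of the norm of \<open>diag_deriv \<phi>\<close> in \<open>L\<^sup>2\<close>, because both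
  terms of the \<open>H(div)\<close> norm of a test field are controlled by its diagonal derivatives.
\<close>

lemma functional_diag_representation:
  fixes \<Omega> :: "(real^'n) set"
  assumes "open \<Omega>" and \<Omega>: "\<Omega> \<in> lmeasurable" and R: "\<And>x. x \<in> \<Omega> \<Longrightarrow> norm x \<le> R" "0 \<le> R"
    and w: "w \<in> H0div_dual \<Omega>"
  obtains \<sigma> where "\<sigma> \<in> L2 \<Omega> UNIV"
    "l2_norm \<Omega> \<sigma> \<le> (2 * R + real CARD('n)) * dual_norm \<Omega> w"
    "\<And>\<phi>. \<phi> \<in> test_functions \<Omega> \<Longrightarrow> w \<phi> = l2_inner \<Omega> \<sigma> (diag_deriv \<phi>)"
proof (rule L2_Riesz[OF \<Omega>, of "test_functions \<Omega>" diag_deriv w "(2 * R + real CARD('n)) * dual_norm \<Omega> w"])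
  show "test_functions \<Omega> \<noteq> {}" using test_function_zero by blast
  show "diag_deriv \<phi> \<in> L2 \<Omega> UNIV" if "\<phi> \<in> test_functions \<Omega>" for \<phi>
    by (rule test_function_L2[OF \<Omega> test_function_diag_deriv[OF that]])
  show "\<bar>w \<phi>\<bar> \<le> (2 * R + real CARD('n)) * dual_norm \<Omega> w * l2_norm \<Omega> (diag_deriv \<phi>)"
    if \<phi>: "\<phi> \<in> test_functions \<Omega>" for \<phi>
  proof -
    note \<phi>' = test_function_H0div[OF assms(1,2) \<phi>]
    have div: "l2_norm \<Omega> (weak_div \<Omega> \<phi>) = l2_norm \<Omega> (classical_div \<phi>)"
      using weak_div_eqI[OF assms(1,2) is_weak_div_test_function[OF \<Omega> \<phi>]] H0divD(3)[OF \<phi>']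
        test_function_L2[OF \<Omega> test_function_classical_div[OF \<phi>]] by (rule l2_norm_cong_AE)
    have "Hdiv_norm \<Omega> \<phi> \<le> l2_norm \<Omega> \<phi> + l2_norm \<Omega> (weak_div \<Omega> \<phi>)"
      unfolding Hdiv_norm_def by (rule sqrt_sum_squares_le_sum) auto
    also have "\<dots> \<le> 2 * R * l2_norm \<Omega> (diag_deriv \<phi>) + real CARD('n) * l2_norm \<Omega> (diag_deriv \<phi>)"
      unfolding div by (intro add_mono l2_norm_le_diag_deriv l2_norm_classical_div_le \<Omega> \<phi> R)
    finally have "dual_norm \<Omega> w * Hdiv_norm \<Omega> \<phi>
        \<le> dual_norm \<Omega> w * ((2 * R + real CARD('n)) * l2_norm \<Omega> (diag_deriv \<phi>))"
      by (intro mult_left_mono dual_norm_bound(1)[OF assms(1,2) w]) (simp add: algebra_simps)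
    with dual_norm_bound(2)[OF assms(1,2) w \<phi>'] show ?thesis by (simp add: mult_ac)
  qed
  show "\<exists>k\<in>test_functions \<Omega>. w k = a * w \<phi> + b * w \<psi> \<and>
      (AE x in lebesgue_on \<Omega>. diag_deriv k x = a *\<^sub>R diag_deriv \<phi> x + b *\<^sub>R diag_deriv \<psi> x)"
    if \<phi>: "\<phi> \<in> test_functions \<Omega>" and \<psi>: "\<psi> \<in> test_functions \<Omega>" for \<phi> \<psi> a b
  proof (intro bexI conjI)
    let ?k = "\<lambda>x. a *\<^sub>R \<phi> x + b *\<^sub>R \<psi> x"
    show "w ?k = a * w \<phi> + b * w \<psi>"
      by (rule H0div_dual_combination[OF assms(1,2) w test_function_H0div[OF assms(1,2) \<phi>]
            test_function_H0div[OF assms(1,2) \<psi>]])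
    show "?k \<in> test_functions \<Omega>"
      by (intro test_function_add test_function_linear[OF bounded_linear_scaleR_right] \<phi> \<psi>)
    have "(?k has_derivative (\<lambda>h. a *\<^sub>R frechet_derivative \<phi> (at x) h + b *\<^sub>R frechet_derivative \<psi> (at x) h)) (at x)"
      for x
      by (intro has_derivative_add has_derivative_scaleR_right smooth_has_derivative
          test_function_smooth[OF \<phi>] test_function_smooth[OF \<psi>])
    from fun_cong[OF frechet_derivative_at[OF this]]
    have "frechet_derivative ?k (at x) h = a *\<^sub>R frechet_derivative \<phi> (at x) h + b *\<^sub>R frechet_derivative \<psi> (at x) h"
      for x h by (rule sym)
    then show "AE x in lebesgue_on \<Omega>. diag_deriv ?k x = a *\<^sub>R diag_deriv \<phi> x + b *\<^sub>R diag_deriv \<psi> x"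
      by (simp add: diag_deriv_def vec_eq_iff)
  qed
  show "0 \<le> (2 * R + real CARD('n)) * dual_norm \<Omega> w"
    using R(2) dual_norm_bound(1)[OF assms(1,2) w] by simp
qed (use that in blast)

definition mean_entry :: "real^'n \<Rightarrow> real" where
  "mean_entry y = (\<Sum>i\<in>UNIV. y $ i) / real CARD('n)"

text \<open>
  The deviatoric part of the diagonal matrix with entries \<open>y\<close>.
\<close>

definition traceless_diag :: "real^'n \<Rightarrow> real^'n^'n" where
  "traceless_diag y = (\<chi> i j. if i = j then y $ i - mean_entry y else 0)"

lemma mean_entry_linear: "bounded_linear mean_entry"
  unfolding linear_conv_bounded_linear[symmetric] mean_entry_def
  by (rule linearI) (simp_all add: sum.distrib add_divide_distrib sum_distrib_left)

lemma traceless_diag_linear: "bounded_linear traceless_diag"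
  unfolding linear_conv_bounded_linear[symmetric]
proof (rule linearI)
  interpret bounded_linear "mean_entry :: real^'n \<Rightarrow> real" by (rule mean_entry_linear)
  show "traceless_diag (x + y) = traceless_diag x + traceless_diag y" for x y :: "real^'n"
    by (simp add: traceless_diag_def vec_eq_iff add)
  show "traceless_diag (c *\<^sub>R x) = c *\<^sub>R traceless_diag x" for c and x :: "real^'n"
    by (simp add: traceless_diag_def vec_eq_iff scaleR algebra_simps)
qed

lemma traceless_diag_sym_traceless: "traceless_diag y \<in> sym_traceless"
  by (auto simp: sym_traceless_def traceless_diag_def transpose_def vec_eq_iff trace_def
      mean_entry_def sum_subtractf)

text \<open>
  Against a Jacobian, the identity matrix picks out the divergence. Removing the trace from a diagonal
  matrix thus trades a divergence of the matrix for a gradient of the mean of its entries.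
\<close>

lemma traceless_diag_inner_jacobian:
  fixes \<phi> :: "real^'n \<Rightarrow> real^'n"
  shows "traceless_diag y \<bullet> jacobian \<phi> (at x)
    = y \<bullet> diag_deriv \<phi> x - mean_entry y * classical_div \<phi> x"
proof -
  have "traceless_diag y \<bullet> jacobian \<phi> (at x)
      = (\<Sum>i\<in>UNIV. \<Sum>j\<in>UNIV. if i = j then (y $ i - mean_entry y) * diag_deriv \<phi> x $ i else 0)"
    by (simp add: traceless_diag_def inner_vec_def jacobian_def matrix_def diag_deriv_def
        if_distrib[where f="\<lambda>t. t * _"] cong: if_cong)
  also have "\<dots> = (\<Sum>i\<in>UNIV. (y $ i - mean_entry y) * diag_deriv \<phi> x $ i)"
    by simp
  also have "\<dots> = y \<bullet> diag_deriv \<phi> x - mean_entry y * classical_div \<phi> x"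
    by (simp add: inner_vec_def classical_div_def left_diff_distrib sum_subtractf sum_distrib_left)
  finally show ?thesis .
qed

lemma integral_classical_div_test_function:
  fixes \<Omega> :: "(real^'n) set"
  assumes \<Omega>: "\<Omega> \<in> lmeasurable" and \<phi>: "\<phi> \<in> test_functions \<Omega>"
  shows "(LINT x|lebesgue_on \<Omega>. classical_div \<phi> x) = 0"
proof -
  have "integrable (lebesgue_on \<Omega>) (\<lambda>x. diag_deriv \<phi> x $ i)" for i
    by (intro L2_integrable[OF \<Omega>] test_function_L2[OF \<Omega>] test_function_component
        test_function_diag_deriv \<phi>)
  then show ?thesis
    using integral_derivative_test_function[OF fmeasurableD[OF \<Omega>] test_function_component[OF \<phi>]]
    by (simp add: classical_div_def diag_deriv_component[OF \<phi>])
qed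

lemma dual_grad_test_function:
  fixes \<Omega> :: "(real^'n) set"
  assumes "open \<Omega>" and \<Omega>: "\<Omega> \<in> lmeasurable" and q: "q \<in> L2 \<Omega> UNIV" and \<phi>: "\<phi> \<in> test_functions \<Omega>"
  shows "dual_grad \<Omega> q \<phi> = - l2_inner \<Omega> q (classical_div \<phi>)"
proof -
  note \<phi>' = test_function_H0div[OF assms(1,2) \<phi>]
  have "l2_inner \<Omega> q (weak_div \<Omega> \<phi>) = l2_inner \<Omega> q (classical_div \<phi>)"
    using weak_div_eqI[OF assms(1,2) is_weak_div_test_function[OF \<Omega> \<phi>]] H0divD(3)[OF \<phi>']
      test_function_L2[OF \<Omega> test_function_classical_div[OF \<phi>]] q
    by (intro l2_inner_cong_AE) auto
  then show ?thesis using \<phi>' by (simp add: dual_grad_def)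
qed

text \<open>
  With \<open>\<sigma>\<close> representing \<open>-w\<close>, the traceless part of the diagonal matrix of \<open>\<sigma>\<close> is \<open>\<tau>\<close>, and \<open>q\<close> is the
  mean entry of \<open>\<sigma>\<close> shifted to zero mean value. In the constant, \<open>\<parallel>q\<parallel>\<close> occurs twice: once for \<open>q\<close> itself
  and once because \<open>div \<tau> = w - \<nabla> q\<close>.
\<close>

lemma regular_decomposition:
  fixes \<Omega> :: "(real^'n) set"
  assumes "open \<Omega>" and \<Omega>: "\<Omega> \<in> lmeasurable" and R: "\<And>x. x \<in> \<Omega> \<Longrightarrow> norm x \<le> R" "0 \<le> R"
    and w: "w \<in> H0div_dual \<Omega>"
  defines "c \<equiv> 2 * R + real CARD('n)"
  obtains \<tau> q where "\<tau> \<in> Hcurldiv \<Omega>" "q \<in> L2_zero_mean \<Omega>"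
    "w = dual_add (dual_div \<Omega> \<tau>) (dual_grad \<Omega> q)"
    "Hcurldiv_norm \<Omega> \<tau> + l2_norm \<Omega> q
      \<le> (1 + (onorm (traceless_diag :: real^'n \<Rightarrow> _) + 2 * onorm (mean_entry :: real^'n \<Rightarrow> _)) * c) * dual_norm \<Omega> w"
proof -
  let ?L = "traceless_diag :: real^'n \<Rightarrow> real^'n^'n" and ?m = "mean_entry :: real^'n \<Rightarrow> real"
  obtain s where s: "s \<in> L2 \<Omega> UNIV" "l2_norm \<Omega> s \<le> c * dual_norm \<Omega> w"
    "\<And>\<phi>. \<phi> \<in> test_functions \<Omega> \<Longrightarrow> w \<phi> = l2_inner \<Omega> s (diag_deriv \<phi>)"
    unfolding c_def using functional_diag_representation[OF assms(1,2) R w] by blast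
  define \<sigma> where "\<sigma> x = (-1) *\<^sub>R s x" for x
  have \<sigma>: "\<sigma> \<in> L2 \<Omega> UNIV"
    unfolding \<sigma>_def by (rule L2_scaleR[OF s(1)])
  have \<sigma>_norm: "l2_norm \<Omega> \<sigma> \<le> c * dual_norm \<Omega> w"
    unfolding \<sigma>_def l2_norm_scaleR using s(2) by simp
  have \<sigma>_repr: "w \<phi> = - l2_inner \<Omega> \<sigma> (diag_deriv \<phi>)" if "\<phi> \<in> test_functions \<Omega>" for \<phi>
    unfolding \<sigma>_def l2_inner_scaleR_left using s(3)[OF that] by simp
  define \<tau> where "\<tau> x = ?L (\<sigma> x)" for x
  define p where "p x = ?m (\<sigma> x)" for x
  have \<tau>: "\<tau> \<in> L2 \<Omega> UNIV" "l2_norm \<Omega> \<tau> \<le> onorm ?L * l2_norm \<Omega> \<sigma>"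
    unfolding \<tau>_def[abs_def] by (rule L2_bounded_linear[OF traceless_diag_linear \<sigma>])+
  have p: "p \<in> L2 \<Omega> UNIV" "l2_norm \<Omega> p \<le> onorm ?m * l2_norm \<Omega> \<sigma>"
    unfolding p_def[abs_def] by (rule L2_bounded_linear[OF mean_entry_linear \<sigma>])+
  obtain a where a: "(\<lambda>x. p x - a) \<in> L2_zero_mean \<Omega>" "l2_norm \<Omega> (\<lambda>x. p x - a) \<le> l2_norm \<Omega> p"
    using L2_zero_mean_projection[OF \<Omega> p(1)] by blast
  define q where "q x = p x - a" for x
  have q: "q \<in> L2_zero_mean \<Omega>" "l2_norm \<Omega> q \<le> l2_norm \<Omega> p"
    unfolding q_def[abs_def] by (fact a)+
  have qL2: "q \<in> L2 \<Omega> UNIV" using q(1) by (simp add: L2_zero_mean_def)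
  note dg = dual_grad_in_dual[OF assms(1,2) qL2]
  define F where "F v = w v + (-1) * dual_grad \<Omega> q v" for v
  have F: "F \<in> H0div_dual \<Omega>"
    unfolding F_def by (rule H0div_dual_lincomb[OF assms(1,2) w dg(1)])
  have "is_dual_div \<Omega> \<tau> F"
    unfolding is_dual_div_def
  proof (intro conjI F ballI)
    fix \<phi> :: "real^'n \<Rightarrow> real^'n" assume \<phi>: "\<phi> \<in> test_functions \<Omega>"
    have D: "diag_deriv \<phi> \<in> L2 \<Omega> UNIV" "classical_div \<phi> \<in> L2 \<Omega> UNIV"
      by (intro test_function_L2[OF \<Omega>] test_function_diag_deriv test_function_classical_div \<phi>)+
    have "l2_inner \<Omega> q (classical_div \<phi>) = l2_inner \<Omega> p (classical_div \<phi>) - l2_inner \<Omega> (\<lambda>x. a) (classical_div \<phi>)"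
      unfolding q_def[abs_def] by (rule l2_inner_diff_left[OF p(1) L2_const[OF \<Omega>] D(2)])
    also have "l2_inner \<Omega> (\<lambda>x. a) (classical_div \<phi>) = 0"
      using integral_classical_div_test_function[OF \<Omega> \<phi>] by (simp add: l2_inner_def)
    finally have q_div: "l2_inner \<Omega> q (classical_div \<phi>) = l2_inner \<Omega> p (classical_div \<phi>)" by simp
    have "l2_inner \<Omega> \<tau> (\<lambda>x. jacobian \<phi> (at x))
        = (LINT x|lebesgue_on \<Omega>. \<sigma> x \<bullet> diag_deriv \<phi> x - p x \<bullet> classical_div \<phi> x)"
      by (simp add: l2_inner_def \<tau>_def p_def traceless_diag_inner_jacobian)
    also have "\<dots> = l2_inner \<Omega> \<sigma> (diag_deriv \<phi>) - l2_inner \<Omega> p (classical_div \<phi>)"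
      unfolding l2_inner_def by (intro Bochner_Integration.integral_diff L2_inner_integrable \<sigma> p D)
    finally show "F \<phi> = distr_div \<Omega> \<tau> \<phi>"
      using \<sigma>_repr[OF \<phi>] dual_grad_test_function[OF assms(1,2) qL2 \<phi>] q_div
      by (simp add: F_def distr_div_def)
  qed
  then have dual_div: "dual_div \<Omega> \<tau> = F" by (rule dual_div_eqI[OF assms(1,2)])
  have \<tau>_mem: "\<tau> \<in> Hcurldiv \<Omega>"
    using \<tau>(1) \<open>is_dual_div \<Omega> \<tau> F\<close> traceless_diag_sym_traceless
    by (auto simp: Hcurldiv_def L2_def \<tau>_def)
  have "dual_norm \<Omega> F \<le> dual_norm \<Omega> w + l2_norm \<Omega> q"
  proof (rule dual_norm_le[OF assms(1,2)])
    show "0 \<le> dual_norm \<Omega> w + l2_norm \<Omega> q"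
      by (intro add_nonneg_nonneg dual_norm_bound(1)[OF assms(1,2) w] l2_norm_nonneg)
    fix v assume v: "v \<in> H0div \<Omega>"
    have "\<bar>F v\<bar> \<le> \<bar>w v\<bar> + \<bar>dual_grad \<Omega> q v\<bar>" by (simp add: F_def)
    also have "\<dots> \<le> dual_norm \<Omega> w * Hdiv_norm \<Omega> v + l2_norm \<Omega> q * Hdiv_norm \<Omega> v"
      using dual_norm_bound(2)[OF assms(1,2) w v] dual_norm_bound(2)[OF assms(1,2) dg(1) v]
        mult_right_mono[OF dg(2) Hdiv_norm_nonneg[of \<Omega> v]] by linarith
    finally show "\<bar>F v\<bar> \<le> (dual_norm \<Omega> w + l2_norm \<Omega> q) * Hdiv_norm \<Omega> v"
      by (simp add: algebra_simps)
  qed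
  moreover have "Hcurldiv_norm \<Omega> \<tau> \<le> l2_norm \<Omega> \<tau> + dual_norm \<Omega> F"
    unfolding Hcurldiv_norm_def dual_div
    by (intro sqrt_sum_squares_le_sum l2_norm_nonneg dual_norm_bound(1)[OF assms(1,2) F])
  moreover have "l2_norm \<Omega> \<tau> \<le> onorm ?L * (c * dual_norm \<Omega> w)"
    by (rule order_trans[OF \<tau>(2) mult_left_mono[OF \<sigma>_norm onorm_pos_le[OF traceless_diag_linear]]])
  moreover have "l2_norm \<Omega> q \<le> onorm ?m * (c * dual_norm \<Omega> w)"
    by (rule order_trans[OF q(2) order_trans[OF p(2) mult_left_mono[OF \<sigma>_norm onorm_pos_le[OF mean_entry_linear]]]])
  ultimately have "Hcurldiv_norm \<Omega> \<tau> + l2_norm \<Omega> q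
      \<le> (1 + (onorm ?L + 2 * onorm ?m) * c) * dual_norm \<Omega> w"
    by (simp add: algebra_simps)
  moreover have "w = dual_add (dual_div \<Omega> \<tau>) (dual_grad \<Omega> q)"
    by (simp add: dual_div dual_add_def F_def[abs_def])
  ultimately show ?thesis using that \<tau>_mem q(1) by blast
qed

theorem lemma3p1:
  fixes \<Omega> :: "(real^'n) set"
  assumes "CARD('n) \<ge> 2"
    and "polytopal_domain \<Omega>" and "bounded \<Omega>" and "connected \<Omega>"
  shows "H0div_dual \<Omega> =
           {dual_add (dual_div \<Omega> \<tau>) (dual_grad \<Omega> q) |\<tau> q. \<tau> \<in> Hcurldiv \<Omega> \<and> q \<in> L2_zero_mean \<Omega>}
       \<and> (\<exists>C>0. \<forall>w\<in>H0div_dual \<Omega>. \<exists>\<tau>\<in>Hcurldiv \<Omega>. \<exists>q\<in>L2_zero_mean \<Omega>.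
            w = dual_add (dual_div \<Omega> \<tau>) (dual_grad \<Omega> q) \<and>
            Hcurldiv_norm \<Omega> \<tau> + l2_norm \<Omega> q \<le> C * dual_norm \<Omega> w)"
proof -
  have "open \<Omega>" using assms(2) by (auto simp: polytopal_domain_def)
  have \<Omega>: "\<Omega> \<in> lmeasurable" by (rule lmeasurable_open[OF \<open>bounded \<Omega>\<close> \<open>open \<Omega>\<close>])
  obtain R where R: "0 < R" "\<And>x. x \<in> \<Omega> \<Longrightarrow> norm x \<le> R"
    using \<open>bounded \<Omega>\<close> by (auto simp: bounded_pos)
  define C where "C = 1 + (onorm (traceless_diag :: real^'n \<Rightarrow> _) + 2 * onorm (mean_entry :: real^'n \<Rightarrow> _))
    * (2 * R + real CARD('n))"
  have "0 < C"
    unfolding C_def using R(1) onorm_pos_le[OF traceless_diag_linear] onorm_pos_le[OF mean_entry_linear]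
    by (intro add_pos_nonneg mult_nonneg_nonneg add_nonneg_nonneg) auto
  have decomposition: "\<exists>\<tau>\<in>Hcurldiv \<Omega>. \<exists>q\<in>L2_zero_mean \<Omega>.
      w = dual_add (dual_div \<Omega> \<tau>) (dual_grad \<Omega> q) \<and>
      Hcurldiv_norm \<Omega> \<tau> + l2_norm \<Omega> q \<le> C * dual_norm \<Omega> w" if "w \<in> H0div_dual \<Omega>" for w
    unfolding C_def
    using regular_decomposition[OF \<open>open \<Omega>\<close> \<Omega> R(2) less_imp_le[OF R(1)] that] by blast
  have "dual_add (dual_div \<Omega> \<tau>) (dual_grad \<Omega> q) \<in> H0div_dual \<Omega>"
    if "\<tau> \<in> Hcurldiv \<Omega>" "q \<in> L2_zero_mean \<Omega>" for \<tau> q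
  proof -
    obtain F where "is_dual_div \<Omega> \<tau> F" using \<open>\<tau> \<in> Hcurldiv \<Omega>\<close> by (auto simp: Hcurldiv_def)
    then have "dual_div \<Omega> \<tau> \<in> H0div_dual \<Omega>"
      using dual_div_eqI[OF \<open>open \<Omega>\<close> \<Omega>] by (simp add: is_dual_div_def)
    moreover have "dual_grad \<Omega> q \<in> H0div_dual \<Omega>"
      using that(2) by (intro dual_grad_in_dual(1)[OF \<open>open \<Omega>\<close> \<Omega>]) (simp add: L2_zero_mean_def)
    ultimately show ?thesis
      using H0div_dual_lincomb[OF \<open>open \<Omega>\<close> \<Omega>, of "dual_div \<Omega> \<tau>" "dual_grad \<Omega> q" 1]
      by (simp add: dual_add_def)
  qed
  then show ?thesis
    using decomposition \<open>0 < C\<close> by blast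
qed

end
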